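(* Let $G$ be a group, $x\in G$, and let $H$ be a finitely generated subgroup of $G$ with $H_b^2(H;\mathbb{R})=0$; put $b=b_1(H)$. Then the maps $$\psi_x^H:\mathrm{InvLO}_x^H(G)\cap\mathrm{Cof}_x^H(G)\to H_b^2(H;\mathbb{Z})=(S^1)^b \quad\text{and}\quad \widetilde{\psi_x^H}:\mathrm{InvLO}_x^H(G)\to S^b=\mathbb{R}^b\cup\{\infty\}$$ are continuous.
   Context: A left ordering of a group $G$ is a total order $<$ on $G$ such that $a<b$ implies $ca<cb$ for all $c\in G$. It is identified with its positive cone $P=\{g\in G: g>1\}$, and we write $<_P$ for the ordering with positive cone $P$. $\mathrm{LO}(G)$ is the set of left orderings of $G$, with the topology generated by the sets $\mathcal{U}_g=\{P\in\mathrm{LO}(G): 1<_P g\}$, $g\in G$ (used as a subbasis); subsets carry the subspace topology. Let $x\in G$ and let $H\subset G$ be a subgroup. $\mathrm{Cof}_x^H(G)$ is the set of $P\in\mathrm{LO}(G)$ such that $x$ is co-final to $H$: for each $a\in H$ there is an integer $N$ with $x^{-N}<_P a<_P x^N$. $\mathrm{InvLO}_x^H(G)$ is the set of $P\in\mathrm{LO}(G)$ such that $b<_P b'$ implies $bx<_P b'x$ for all $b,b'$ in the subgroup generated by $H$ and $x$. For $P\in\mathrm{InvLO}_x^H(G)\cap\mathrm{Cof}_x^H(G)$ define $\rho_{x,P}^H:H\to\mathbb{Z}$ by: $\rho_{x,P}^H(h)$ is the integer $N$ with $x^N\le_P h<_P x^{N+1}$ if $x>_P1$, and the integer $N$ with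 $x^{N+1}<_P h\le_P x^{N}$ if $x<_P1$. This map is a quasi morphism (a map $\phi$ with $|\phi(gg')-\phi(g)-\phi(g')|$ bounded). Let $\overline{\rho_{x,P}^H}(h)=\lim_{N\to\infty}\rho_{x,P}^H(h^N)/N$. For $K=\mathbb{Z}$ or $\mathbb{R}$, $H_b^2(H;K)$ denotes the kernel of the comparison map from the usual second bounded cohomology of $H$ with coefficients in $K$ to $H^2(H;K)$. A quasi morphism $\phi:H\to K$ defines the class $[\phi]\in H_b^2(H;K)$ of the bounded cocycle $d\phi(g,g')=\phi(g)-\phi(gg')+\phi(g')$. Define $\psi_x^H(P)=[\rho_{x,P}^H]\in H_b^2(H;\mathbb{Z})$. When $H_b^2(H;\mathbb{R})=0$, there is an isomorphism $H^1(H;\mathbb{R})/H^1(H;\mathbb{Z})\cong H_b^2(H;\mathbb{Z})$ sending the class of a homomorphism $\tau:H\to\mathbb{R}$ to the class of the quasi morphism $h\mapsto\lfloor\tau(h)\rfloor$. Fix elements $y_1,\dots,y_b\in H$ whose classes form a basis of $H_1(H;\mathbb{Z})$ modulo torsion. Evaluation on $y_1,\dots,y_b$ identifies $H^1(H;\mathbb{R})/H^1(H;\mathbb{Z})$ with the torus $\mathbb{R}^b/\mathbb{Z}^b=(S^1)^b$, and $H_b^2(H;\mathbb{Z})$ is given this topology. The map $\widetilde{\psi_x^H}$ is defined by $\widetilde{\psi_x^H}(P)=(\overline{\rho_{x,P}^H}(y_1),\dots,\overline{\rho_{x,P}^H}(y_b))$ if $P\in\mathrm{InvLO}_x^H(G)\cap\mathrm{Cof}_x^H(G)$,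 and $\widetilde{\psi_x^H}(P)=\infty$ if $P\in\mathrm{InvLO}_x^H(G)\setminus\mathrm{Cof}_x^H(G)$. Here $\mathbb{R}^b\cup\{\infty\}$ is the one-point compactification. *)

theory Defs
  imports "HOL-Analysis.Analysis" "HOL-Algebra.Product_Groups" "HOL-Algebra.FiniteProduct"
begin

section \<open>Left orderings and the space of positive cones\<close>

definition left_orderings :: "('a, 'm) monoid_scheme \<Rightarrow> ('a \<times> 'a) set set" where
  "left_orderings G = {r. r \<subseteq> carrier G \<times> carrier G \<and> strict_linear_order_on (carrier G) r \<and>
     (\<forall>a\<in>carrier G. \<forall>b\<in>carrier G. \<forall>c\<in>carrier G.
        (a, b) \<in> r \<longrightarrow> (c \<otimes>\<^bsub>G\<^esub> a, c \<otimes>\<^bsub>G\<^esub> b) \<in> r)}"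

definition positive_cone :: "('a, 'm) monoid_scheme \<Rightarrow> ('a \<times> 'a) set \<Rightarrow> 'a set" where
  "positive_cone G r = {g \<in> carrier G. (\<one>\<^bsub>G\<^esub>, g) \<in> r}"

definition LO :: "('a, 'm) monoid_scheme \<Rightarrow> 'a set set" where
  "LO G = positive_cone G ` left_orderings G"

definition cone_less :: "('a, 'm) monoid_scheme \<Rightarrow> 'a set \<Rightarrow> 'a \<Rightarrow> 'a \<Rightarrow> bool" where
  "cone_less G P a b \<longleftrightarrow> inv\<^bsub>G\<^esub> a \<otimes>\<^bsub>G\<^esub> b \<in> P"

definition cone_le :: "('a, 'm) monoid_scheme \<Rightarrow> 'a set \<Rightarrow> 'a \<Rightarrow> 'a \<Rightarrow> bool" where
  "cone_le G P a b \<longleftrightarrow> cone_less G P a b \<or> a = b"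

lemma cone_less_positive_cone:
  fixes G (structure)
  assumes "group G" and r: "r \<in> left_orderings G" and a: "a \<in> carrier G" and b: "b \<in> carrier G"
  shows "cone_less G (positive_cone G r) a b \<longleftrightarrow> (a, b) \<in> r"
proof -
  interpret group G by fact
  have inv: "(c \<otimes> u, c \<otimes> v) \<in> r"
    if "(u, v) \<in> r" "u \<in> carrier G" "v \<in> carrier G" "c \<in> carrier G" for u v c
    using r that unfolding left_orderings_def by blast
  have "(a, b) \<in> r" if "(\<one>, inv a \<otimes> b) \<in> r"
    using inv[OF that _ _ a] a b by (simp add: m_assoc[symmetric])
  moreover have "(\<one>, inv a \<otimes> b) \<in> r" if "(a, b) \<in> r"
    using inv[OF that a b, of "inv a"] a b by simp
  ultimately show ?thesis
    using a b by (auto simp: cone_less_def positive_cone_def)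
qed

text \<open>The whole space is added to the subbasis because for the trivial group, whose only positive
  cone is empty, the sets \<open>{P. \<one> <\<^sub>P g}\<close> do not cover \<open>LO G\<close>.\<close>

definition LO_topology :: "('a, 'm) monoid_scheme \<Rightarrow> 'a set topology" where
  "LO_topology G = topology_generated_by
     (insert (LO G) ((\<lambda>g. {P \<in> LO G. cone_less G P \<one>\<^bsub>G\<^esub> g}) ` carrier G))"

lemma topspace_LO_topology: "topspace (LO_topology G) = LO G"
  by (auto simp: LO_topology_def)

definition Cof :: "('a, 'm) monoid_scheme \<Rightarrow> 'a set \<Rightarrow> 'a \<Rightarrow> 'a set set" where
  "Cof G H x = {P \<in> LO G. \<forall>a\<in>H. \<exists>N::int.
     cone_less G P (x [^]\<^bsub>G\<^esub> (- N)) a \<and> cone_less G P a (x [^]\<^bsub>G\<^esub> N)}"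

definition InvLO :: "('a, 'm) monoid_scheme \<Rightarrow> 'a set \<Rightarrow> 'a \<Rightarrow> 'a set set" where
  "InvLO G H x = {P \<in> LO G. \<forall>b\<in>generate G (insert x H). \<forall>b'\<in>generate G (insert x H).
     cone_less G P b b' \<longrightarrow> cone_less G P (b \<otimes>\<^bsub>G\<^esub> x) (b' \<otimes>\<^bsub>G\<^esub> x)}"

definition rho :: "('a, 'm) monoid_scheme \<Rightarrow> 'a \<Rightarrow> 'a set \<Rightarrow> 'a \<Rightarrow> int" where
  "rho G x P h =
     (if cone_less G P \<one>\<^bsub>G\<^esub> x
      then (THE N::int. cone_le G P (x [^]\<^bsub>G\<^esub> N) h \<and> cone_less G P h (x [^]\<^bsub>G\<^esub> (N + 1)))
      else (THE N::int. cone_less G P (x [^]\<^bsub>G\<^esub> (N + 1)) h \<and> cone_le G P h (x [^]\<^bsub>G\<^esub> N)))"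

definition rho_bar :: "('a, 'm) monoid_scheme \<Rightarrow> 'a \<Rightarrow> 'a set \<Rightarrow> 'a \<Rightarrow> real" where
  "rho_bar G x P h = lim (\<lambda>N::nat. real_of_int (rho G x P (h [^]\<^bsub>G\<^esub> N)) / real N)"


section \<open>Group cohomology and bounded cohomology in low degrees\<close>

text \<open>Inhomogeneous cochains with trivial coefficients in the additive group of \<open>'k\<close>, which is
  instantiated to \<open>int\<close> or \<open>real\<close> below; cochains are extensional functions.\<close>

definition cochains :: "'x set \<Rightarrow> ('x \<Rightarrow> 'k::linordered_idom) monoid" where
  "cochains X = product_group X (\<lambda>_. \<lparr>carrier = UNIV, monoid.mult = (+), one = 0\<rparr>)"

abbreviation cochains1 :: "('a, 'm) monoid_scheme \<Rightarrow> ('a \<Rightarrow> 'k::linordered_idom) monoid" where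
  "cochains1 K \<equiv> cochains (carrier K)"

abbreviation cochains2 :: "('a, 'm) monoid_scheme \<Rightarrow> ('a \<times> 'a \<Rightarrow> 'k::linordered_idom) monoid" where
  "cochains2 K \<equiv> cochains (carrier K \<times> carrier K)"

abbreviation cochains3 ::
  "('a, 'm) monoid_scheme \<Rightarrow> ('a \<times> 'a \<times> 'a \<Rightarrow> 'k::linordered_idom) monoid" where
  "cochains3 K \<equiv> cochains (carrier K \<times> carrier K \<times> carrier K)"

definition coboundary1 ::
  "('a, 'm) monoid_scheme \<Rightarrow> ('a \<Rightarrow> 'k::linordered_idom) \<Rightarrow> 'a \<times> 'a \<Rightarrow> 'k" where
  "coboundary1 K \<phi> = restrict (\<lambda>(g, g'). \<phi> g - \<phi> (g \<otimes>\<^bsub>K\<^esub> g') + \<phi> g') (carrier K \<times> carrier K)"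

definition coboundary2 ::
  "('a, 'm) monoid_scheme \<Rightarrow> ('a \<times> 'a \<Rightarrow> 'k::linordered_idom) \<Rightarrow> 'a \<times> 'a \<times> 'a \<Rightarrow> 'k" where
  "coboundary2 K f = restrict
     (\<lambda>(g, h, k). f (h, k) - f (g \<otimes>\<^bsub>K\<^esub> h, k) + f (g, h \<otimes>\<^bsub>K\<^esub> k) - f (g, h))
     (carrier K \<times> carrier K \<times> carrier K)"

definition bounded_cochains :: "'x set \<Rightarrow> ('x \<Rightarrow> 'k::linordered_idom) set" where
  "bounded_cochains X = {f \<in> carrier (cochains X). \<exists>B. \<forall>t\<in>X. \<bar>f t\<bar> \<le> B}"

definition cocycles2 :: "('a, 'm) monoid_scheme \<Rightarrow> ('a \<times> 'a \<Rightarrow> 'k::linordered_idom) set" where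
  "cocycles2 K = kernel (cochains2 K) (cochains3 K) (coboundary2 K)"

definition coboundaries2 :: "('a, 'm) monoid_scheme \<Rightarrow> ('a \<times> 'a \<Rightarrow> 'k::linordered_idom) set" where
  "coboundaries2 K = coboundary1 K ` carrier (cochains1 K)"

definition bounded_cocycles2 ::
  "('a, 'm) monoid_scheme \<Rightarrow> ('a \<times> 'a \<Rightarrow> 'k::linordered_idom) set" where
  "bounded_cocycles2 K = cocycles2 K \<inter> bounded_cochains (carrier K \<times> carrier K)"

definition bounded_coboundaries2 ::
  "('a, 'm) monoid_scheme \<Rightarrow> ('a \<times> 'a \<Rightarrow> 'k::linordered_idom) set" where
  "bounded_coboundaries2 K = coboundary1 K ` bounded_cochains (carrier K)"

definition cohomology2 ::
  "('a, 'm) monoid_scheme \<Rightarrow> ('a \<times> 'a \<Rightarrow> 'k::linordered_idom) set monoid" where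
  "cohomology2 K = (cochains2 K\<lparr>carrier := cocycles2 K\<rparr>) Mod coboundaries2 K"

definition bounded_cohomology2 ::
  "('a, 'm) monoid_scheme \<Rightarrow> ('a \<times> 'a \<Rightarrow> 'k::linordered_idom) set monoid" where
  "bounded_cohomology2 K =
     (cochains2 K\<lparr>carrier := bounded_cocycles2 K\<rparr>) Mod bounded_coboundaries2 K"

definition comparison2 :: "('a, 'm) monoid_scheme \<Rightarrow>
    ('a \<times> 'a \<Rightarrow> 'k::linordered_idom) set \<Rightarrow> ('a \<times> 'a \<Rightarrow> 'k) set" where
  "comparison2 K c = the_elem ((\<lambda>f. coboundaries2 K #>\<^bsub>cochains2 K\<^esub> f) ` c)"

text \<open>\<open>Hb2 K\<close> is the kernel of the comparison map, not the full second bounded cohomology.\<close>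

definition Hb2 ::
  "('a, 'm) monoid_scheme \<Rightarrow> ('a \<times> 'a \<Rightarrow> 'k::linordered_idom) set monoid" where
  "Hb2 K = (bounded_cohomology2 K)
     \<lparr>carrier := kernel (bounded_cohomology2 K) (cohomology2 K) (comparison2 K)\<rparr>"

definition qm_class :: "('a, 'm) monoid_scheme \<Rightarrow>
    ('a \<Rightarrow> 'k::linordered_idom) \<Rightarrow> ('a \<times> 'a \<Rightarrow> 'k) set" where
  "qm_class K \<phi> = bounded_coboundaries2 K #>\<^bsub>cochains2 K\<^esub> coboundary1 K \<phi>"

definition psi ::
  "('a, 'm) monoid_scheme \<Rightarrow> 'a set \<Rightarrow> 'a \<Rightarrow> 'a set \<Rightarrow> ('a \<times> 'a \<Rightarrow> int) set" where
  "psi G H x P = qm_class (G\<lparr>carrier := H\<rparr>) (rho G x P)"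


section \<open>First homology modulo torsion\<close>

definition torsion_subgroup :: "('a, 'm) monoid_scheme \<Rightarrow> 'a set" where
  "torsion_subgroup A = {a \<in> carrier A. \<exists>n::nat. n > 0 \<and> a [^]\<^bsub>A\<^esub> n = \<one>\<^bsub>A\<^esub>}"

definition homology1 :: "('a, 'm) monoid_scheme \<Rightarrow> 'a set monoid" where
  "homology1 K = K Mod derived K (carrier K)"

definition homology1_free :: "('a, 'm) monoid_scheme \<Rightarrow> 'a set set monoid" where
  "homology1_free K = homology1 K Mod torsion_subgroup (homology1 K)"

definition homology1_class :: "('a, 'm) monoid_scheme \<Rightarrow> 'a \<Rightarrow> 'a set set" where
  "homology1_class K h =
     torsion_subgroup (homology1 K) #>\<^bsub>homology1 K\<^esub> (derived K (carrier K) #>\<^bsub>K\<^esub> h)"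

definition homology1_basis :: "('a, 'm) monoid_scheme \<Rightarrow> nat \<Rightarrow> (nat \<Rightarrow> 'a) \<Rightarrow> bool" where
  "homology1_basis K b y \<longleftrightarrow> (\<forall>i<b. y i \<in> carrier K) \<and>
     (\<forall>c\<in>carrier (homology1_free K). \<exists>!n. n \<in> {..<b} \<rightarrow>\<^sub>E (UNIV :: int set) \<and>
        c = finprod (homology1_free K)
              (\<lambda>i. homology1_class K (y i) [^]\<^bsub>homology1_free K\<^esub> n i) {..<b})"

definition betti1 :: "('a, 'm) monoid_scheme \<Rightarrow> nat" where
  "betti1 K = (THE b. \<exists>y. homology1_basis K b y)"


section \<open>The torus topology and the two target spaces\<close>

text \<open>The degree 0 coboundary vanishes for trivial coefficients, so first cohomology is the group
  of 1-cocycles, that is, of homomorphisms to the coefficients.\<close>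

definition cohomology1 :: "('a, 'm) monoid_scheme \<Rightarrow> ('a \<Rightarrow> 'k::linordered_idom) monoid" where
  "cohomology1 K = cochains1 K\<lparr>carrier := kernel (cochains1 K) (cochains2 K) (coboundary1 K)\<rparr>"

definition cohomology1_real_mod_int :: "('a, 'm) monoid_scheme \<Rightarrow> ('a \<Rightarrow> real) set monoid" where
  "cohomology1_real_mod_int K = cohomology1 K Mod
     ((\<lambda>\<sigma>. \<lambda>h\<in>carrier K. real_of_int (\<sigma> h)) ` carrier (cohomology1 K))"

definition floor_iso :: "('a, 'm) monoid_scheme \<Rightarrow> ('a \<Rightarrow> real) set \<Rightarrow> ('a \<times> 'a \<Rightarrow> int) set" where
  "floor_iso K c = the_elem ((\<lambda>\<tau>. qm_class K (\<lambda>h. \<lfloor>\<tau> h\<rfloor>)) ` c)"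

definition torus :: "nat \<Rightarrow> (nat \<Rightarrow> complex) topology" where
  "torus b = product_topology (\<lambda>_. top_of_set (sphere 0 1)) {..<b}"

text \<open>Here \<open>\<real>/\<int>\<close> is identified with the unit circle by \<open>t \<mapsto> exp (2 \<pi> \<i> t)\<close>.\<close>

definition torus_coords :: "nat \<Rightarrow> (nat \<Rightarrow> 'a) \<Rightarrow> ('a \<Rightarrow> real) set \<Rightarrow> nat \<Rightarrow> complex" where
  "torus_coords b y c = the_elem ((\<lambda>\<tau>. \<lambda>i\<in>{..<b}. cis (2 * pi * \<tau> (y i))) ` c)"

text \<open>The topology making the composite
  \<open>Hb2 K \<cong> cohomology1_real_mod_int K \<cong> torus b\<close> a homeomorphism, in the situation
  where \<open>floor_iso K\<close> and \<open>torus_coords b y\<close> are bijections.\<close>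

definition Hb2_topology ::
  "('a, 'm) monoid_scheme \<Rightarrow> nat \<Rightarrow> (nat \<Rightarrow> 'a) \<Rightarrow> ('a \<times> 'a \<Rightarrow> int) set topology" where
  "Hb2_topology K b y = pullback_topology (carrier (Hb2 K))
     (torus_coords b y \<circ> inv_into (carrier (cohomology1_real_mod_int K)) (floor_iso K)) (torus b)"

text \<open>In \<open>Alexandroff_compactification (Euclidean_space b)\<close> the point at infinity is \<open>None\<close>, and
  vectors are functions on \<open>nat\<close> vanishing from index \<open>b\<close> on.\<close>

definition psi_tilde :: "('a, 'm) monoid_scheme \<Rightarrow> 'a set \<Rightarrow> 'a \<Rightarrow> nat \<Rightarrow> (nat \<Rightarrow> 'a) \<Rightarrow>
    'a set \<Rightarrow> (nat \<Rightarrow> real) option" where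
  "psi_tilde G H x b y P =
     (if P \<in> Cof G H x then Some (\<lambda>i. if i < b then rho_bar G x P (y i) else 0) else None)"

end

theory Submission
  imports Defs
begin

text \<open>
  Reversing the order if necessary, \<open>x\<close> is positive, and then \<open>\<rho>(h)\<close> is the exponent of the
  largest power of \<open>x\<close> below \<open>h\<close>. Right invariance under \<open>x\<close> gives
  \<open>\<rho>(g) + \<rho>(h) \<le> \<rho>(g h) \<le> \<rho>(g) + \<rho>(h) + 1\<close>, so the homogenization differs from
  \<open>\<rho>(h\<^sup>n) / n\<close> by at most \<open>1 / n\<close>, uniformly in the ordering. As \<open>\<rho>(h\<^sup>n) = N\<close> is an open condition,
  the homogenization at \<open>h\<close> is continuous in the ordering.

  Since the second bounded cohomology kernel vanishes, \<open>\<rho>\<close> is a homomorphism up to a bounded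
  error. This homomorphism is the homogenization, so the torus coordinates of the class of \<open>\<rho>\<close>
  are its values at the \<open>y\<^sub>i\<close> modulo 1.

  Cofinality is inherited from generators of \<open>H\<close>, hence open. If it fails at an ordering, some
  \<open>c \<in> H\<close> lies above all powers of \<open>x\<close>, and the homogenization at \<open>c\<close> is arbitrarily large nearby.
  It is a fixed integer combination of the values at the \<open>y\<^sub>i\<close>, so these leave every compact set.
\<close>

section \<open>Classes of quasimorphisms\<close>

lemma carrier_cochains [simp]: "carrier (cochains X) = X \<rightarrow>\<^sub>E UNIV"
  by (simp add: cochains_def)

lemma mult_cochains [simp]: "f \<otimes>\<^bsub>cochains X\<^esub> g = (\<lambda>t\<in>X. f t + g t)"
  by (simp add: cochains_def)

lemma one_cochains [simp]: "\<one>\<^bsub>cochains X\<^esub> = (\<lambda>t\<in>X. 0)"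
  by (simp add: cochains_def)

lemma restrict_mem_bounded_cochains:
  assumes "\<And>t. t \<in> X \<Longrightarrow> \<bar>f t\<bar> \<le> B"
  shows "restrict f X \<in> bounded_cochains X"
  using assms by (auto simp: bounded_cochains_def)

lemma coboundary1_restrict:
  assumes "group K"
  shows "coboundary1 K (restrict \<phi> (carrier K)) = coboundary1 K \<phi>"
proof -
  interpret group K by fact
  show ?thesis by (auto simp: coboundary1_def fun_eq_iff restrict_def)
qed

lemma coboundary1_add:
  "coboundary1 K \<phi> \<otimes>\<^bsub>cochains2 K\<^esub> coboundary1 K \<phi>' = coboundary1 K (\<lambda>g. \<phi> g + \<phi>' g)"
  by (rule ext) (simp add: coboundary1_def restrict_def algebra_simps split: prod.splits)

lemma coboundary1_eq_iff:
  "coboundary1 K \<phi> = coboundary1 K \<phi>' \<longleftrightarrow>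
    (\<forall>g\<in>carrier K. \<forall>h\<in>carrier K. \<phi> g - \<phi> (g \<otimes>\<^bsub>K\<^esub> h) + \<phi> h = \<phi>' g - \<phi>' (g \<otimes>\<^bsub>K\<^esub> h) + \<phi>' h)"
  (is "?L \<longleftrightarrow> ?R")
proof
  assume L: ?L
  show ?R
  proof (intro ballI)
    fix g h assume "g \<in> carrier K" "h \<in> carrier K"
    with fun_cong[OF L, of "(g, h)"] show "\<phi> g - \<phi> (g \<otimes>\<^bsub>K\<^esub> h) + \<phi> h = \<phi>' g - \<phi>' (g \<otimes>\<^bsub>K\<^esub> h) + \<phi>' h"
      by (simp add: coboundary1_def)
  qed
qed (auto simp: coboundary1_def intro!: restrict_ext)

lemma mem_coboundaries2: "group K \<Longrightarrow> coboundary1 K \<phi> \<in> coboundaries2 K"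
  unfolding coboundaries2_def
  by (rule image_eqI[where x = "restrict \<phi> (carrier K)"]) (auto simp: coboundary1_restrict)

text \<open>Cosets are taken modulo bounded coboundaries, and sums of coboundaries are coboundaries
  of sums. A class can thus be handled through functions, by adding bounded cochains to
  \<open>\<phi>\<close>.\<close>

lemma mem_qm_class_iff:
  "f \<in> qm_class K \<phi> \<longleftrightarrow>
    (\<exists>\<beta>\<in>bounded_cochains (carrier K). f = coboundary1 K (\<lambda>g. \<beta> g + \<phi> g))"
  unfolding qm_class_def r_coset_def bounded_coboundaries2_def
  by (simp add: coboundary1_add Bex_def image_iff del: mult_cochains) blast

lemma zero_mem_bounded_cochains: "(\<lambda>t\<in>X. 0) \<in> bounded_cochains X"
  by (auto simp: bounded_cochains_def)

lemma coboundary1_mem_qm_class: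
  assumes "group K" shows "coboundary1 K \<phi> \<in> qm_class K \<phi>"
proof -
  have "coboundary1 K \<phi> = coboundary1 K (\<lambda>g. (\<lambda>t\<in>carrier K. 0) g + \<phi> g)"
  proof -
    interpret group K by fact
    show ?thesis by (simp add: coboundary1_eq_iff)
  qed
  then show ?thesis using zero_mem_bounded_cochains unfolding mem_qm_class_iff by blast
qed

text \<open>A homomorphism has zero coboundary, so it can be discarded and only a bounded cochain
  remains. Nonzero \<open>\<sigma>\<close> serves for integral cosets, \<open>\<sigma> = 0\<close>
  for functions at bounded distance.\<close>

lemma qm_class_eqI:
  assumes "group K"
    and \<sigma>: "\<And>g h. g \<in> carrier K \<Longrightarrow> h \<in> carrier K \<Longrightarrow> \<sigma> (g \<otimes>\<^bsub>K\<^esub> h) = \<sigma> g + \<sigma> h"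
    and B: "\<And>g. g \<in> carrier K \<Longrightarrow> \<bar>\<phi> g - \<phi>' g - \<sigma> g\<bar> \<le> B"
  shows "qm_class K \<phi> = qm_class K \<phi>'"
proof -
  interpret group K by fact
  have "qm_class K u \<subseteq> qm_class K v"
    if s: "\<And>g h. g \<in> carrier K \<Longrightarrow> h \<in> carrier K \<Longrightarrow> s (g \<otimes>\<^bsub>K\<^esub> h) = s g + s h"
      and B: "\<And>g. g \<in> carrier K \<Longrightarrow> \<bar>u g - v g - s g\<bar> \<le> B" for u v s
  proof
    fix f assume "f \<in> qm_class K u"
    then obtain \<beta> where \<beta>: "\<beta> \<in> bounded_cochains (carrier K)" "f = coboundary1 K (\<lambda>g. \<beta> g + u g)"
      by (auto simp: mem_qm_class_iff)
    then obtain B' where B': "\<And>g. g \<in> carrier K \<Longrightarrow> \<bar>\<beta> g\<bar> \<le> B'" by (auto simp: bounded_cochains_def)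
    \<comment> \<open>Subtracting \<open>s\<close> makes this cochain bounded and, since
      \<open>s\<close> has zero coboundary, leaves \<open>f\<close> unchanged.\<close>
    let ?\<gamma> = "\<lambda>g\<in>carrier K. \<beta> g + u g - v g - s g"
    have "?\<gamma> \<in> bounded_cochains (carrier K)"
    proof (rule restrict_mem_bounded_cochains)
      fix g assume "g \<in> carrier K"
      with B[of g] B'[of g] show "\<bar>\<beta> g + u g - v g - s g\<bar> \<le> B' + B" by linarith
    qed
    moreover have "f = coboundary1 K (\<lambda>g. ?\<gamma> g + v g)"
      unfolding \<beta>(2) coboundary1_eq_iff by (simp add: s)
    ultimately show "f \<in> qm_class K v" unfolding mem_qm_class_iff by blast
  qed
  note sub = this
  have "\<bar>\<phi>' g - \<phi> g - - \<sigma> g\<bar> \<le> B" if "g \<in> carrier K" for g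
    using B[OF that] by linarith
  then show ?thesis
    using sub[of \<sigma> \<phi> \<phi>', OF \<sigma> B] sub[of "\<lambda>g. - \<sigma> g" \<phi>' \<phi>] \<sigma> by (simp add: subset_antisym)
qed

text \<open>Equal classes give coboundaries that agree after a bounded correction
  \<open>\<beta>\<close>. The corrected difference then has zero coboundary, which is
  additivity.\<close>

lemma qm_class_eqD:
  assumes "group K" and "qm_class K \<phi> = qm_class K \<phi>'"
  obtains \<beta> B where "\<And>g. g \<in> carrier K \<Longrightarrow> \<bar>\<beta> g\<bar> \<le> B"
    and "\<And>g h. g \<in> carrier K \<Longrightarrow> h \<in> carrier K \<Longrightarrow>
      \<phi> (g \<otimes>\<^bsub>K\<^esub> h) - \<phi>' (g \<otimes>\<^bsub>K\<^esub> h) - \<beta> (g \<otimes>\<^bsub>K\<^esub> h) = (\<phi> g - \<phi>' g - \<beta> g) + (\<phi> h - \<phi>' h - \<beta> h)"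
proof -
  have "coboundary1 K \<phi> \<in> qm_class K \<phi>'"
    using assms coboundary1_mem_qm_class by blast
  then obtain \<beta> where \<beta>: "\<beta> \<in> bounded_cochains (carrier K)"
      and eq: "coboundary1 K \<phi> = coboundary1 K (\<lambda>g. \<beta> g + \<phi>' g)"
    by (auto simp: mem_qm_class_iff)
  from \<beta> obtain B where B: "\<And>g. g \<in> carrier K \<Longrightarrow> \<bar>\<beta> g\<bar> \<le> B" by (auto simp: bounded_cochains_def)
  show thesis
  proof (rule that[of \<beta> B, OF B])
    fix g h assume "g \<in> carrier K" "h \<in> carrier K"
    with eq have "\<phi> g - \<phi> (g \<otimes>\<^bsub>K\<^esub> h) + \<phi> h
        = (\<beta> g + \<phi>' g) - (\<beta> (g \<otimes>\<^bsub>K\<^esub> h) + \<phi>' (g \<otimes>\<^bsub>K\<^esub> h)) + (\<beta> h + \<phi>' h)"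
      unfolding coboundary1_eq_iff by blast
    then show "\<phi> (g \<otimes>\<^bsub>K\<^esub> h) - \<phi>' (g \<otimes>\<^bsub>K\<^esub> h) - \<beta> (g \<otimes>\<^bsub>K\<^esub> h) = (\<phi> g - \<phi>' g - \<beta> g) + (\<phi> h - \<phi>' h - \<beta> h)"
      by (simp add: algebra_simps)
  qed
qed

section \<open>The kernel of the comparison map and its vanishing\<close>

lemma coboundary1_mem_cocycles2:
  assumes "group K" shows "coboundary1 K \<phi> \<in> cocycles2 K"
proof -
  interpret group K by fact
  show ?thesis
    unfolding cocycles2_def kernel_def
    by (auto simp: coboundary1_def coboundary2_def fun_eq_iff m_assoc)
qed

lemma coboundaries2_coset:
  assumes "group K" and "f \<in> coboundaries2 K"
  shows "coboundaries2 K #>\<^bsub>cochains2 K\<^esub> f = coboundaries2 K"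
proof -
  obtain \<phi> where f: "f = coboundary1 K \<phi>" using assms(2) by (auto simp: coboundaries2_def)
  have "c \<otimes>\<^bsub>cochains2 K\<^esub> f \<in> coboundaries2 K" if "c \<in> coboundaries2 K" for c
    using that mem_coboundaries2[OF assms(1)] by (auto simp: coboundaries2_def f coboundary1_add simp del: mult_cochains)
  moreover have "\<exists>c'\<in>coboundaries2 K. c = c' \<otimes>\<^bsub>cochains2 K\<^esub> f" if mem: "c \<in> coboundaries2 K" for c
  proof -
    obtain \<phi>' where c: "c = coboundary1 K \<phi>'" using mem by (auto simp: coboundaries2_def)
    have "c = coboundary1 K (\<lambda>g. \<phi>' g - \<phi> g) \<otimes>\<^bsub>cochains2 K\<^esub> f"
      unfolding c f coboundary1_add by simp
    then show ?thesis using mem_coboundaries2[OF assms(1)] by blast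
  qed
  ultimately show ?thesis unfolding r_coset_def by fast
qed

text \<open>The cocycle is bounded, but it is also the coboundary of the possibly unbounded
  \<open>\<phi>\<close>, so the comparison map sends its class to zero.\<close>

lemma qm_class_mem_Hb2:
  fixes \<phi> :: "'a \<Rightarrow> 'k::linordered_idom"
  assumes "group K"
    and B: "\<And>g h. g \<in> carrier K \<Longrightarrow> h \<in> carrier K \<Longrightarrow> \<bar>\<phi> g - \<phi> (g \<otimes>\<^bsub>K\<^esub> h) + \<phi> h\<bar> \<le> B"
  shows "qm_class K \<phi> \<in> carrier (Hb2 K)"
proof -
  have "coboundary1 K \<phi> \<in> bounded_cocycles2 K"
    using coboundary1_mem_cocycles2[OF assms(1)] B
    by (auto simp: bounded_cocycles2_def coboundary1_def intro!: restrict_mem_bounded_cochains)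
  then have 1: "qm_class K \<phi> \<in> carrier (bounded_cohomology2 K)"
    unfolding qm_class_def bounded_cohomology2_def FactGroup_def RCOSETS_def
    by (auto simp: r_coset_def)
  \<comment> \<open>\<open>comparison2\<close> picks the element of an image set, so this image has
    to be shown to be a singleton.\<close>
  have "(\<lambda>f. coboundaries2 K #>\<^bsub>cochains2 K\<^esub> f) ` qm_class K \<phi> = {coboundaries2 K}"
  proof -
    have "coboundaries2 K #>\<^bsub>cochains2 K\<^esub> f = coboundaries2 K" if "f \<in> qm_class K \<phi>" for f
      using that coboundaries2_coset[OF assms(1) mem_coboundaries2[OF assms(1)]]
      unfolding mem_qm_class_iff by blast
    then show ?thesis using coboundary1_mem_qm_class[OF assms(1), of \<phi>] by blast
  qed
  then have "comparison2 K (qm_class K \<phi>) = coboundaries2 K"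
    by (simp add: comparison2_def)
  with 1 show ?thesis
    by (simp add: Hb2_def kernel_def cohomology2_def)
qed

text \<open>Triviality forces \<open>\<phi>\<close> and the zero function into the same class. The
  bounded correction that witnesses this equality turns \<open>\<phi>\<close> into a
  homomorphism.\<close>

lemma quasimorphism_decomposition:
  fixes \<phi> :: "'a \<Rightarrow> real"
  assumes "group K"
    and trivial: "carrier (Hb2 K :: ('a \<times> 'a \<Rightarrow> real) set monoid) = {\<one>\<^bsub>Hb2 K\<^esub>}"
    and B: "\<And>g h. g \<in> carrier K \<Longrightarrow> h \<in> carrier K \<Longrightarrow> \<bar>\<phi> g - \<phi> (g \<otimes>\<^bsub>K\<^esub> h) + \<phi> h\<bar> \<le> B"
  obtains \<tau> B' where "\<And>g h. g \<in> carrier K \<Longrightarrow> h \<in> carrier K \<Longrightarrow> \<tau> (g \<otimes>\<^bsub>K\<^esub> h) = \<tau> g + \<tau> h"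
    and "\<And>g. g \<in> carrier K \<Longrightarrow> \<bar>\<phi> g - \<tau> g\<bar> \<le> B'"
proof -
  interpret group K by fact
  \<comment> \<open>The identity of the quotient is the subgroup
    \<open>bounded_coboundaries2 K\<close> itself.\<close>
  have Hb2: "qm_class K u \<in> {bounded_coboundaries2 K}"
    if "\<And>g h. g \<in> carrier K \<Longrightarrow> h \<in> carrier K \<Longrightarrow> \<bar>u g - u (g \<otimes>\<^bsub>K\<^esub> h) + u h\<bar> \<le> C" for u :: "'a \<Rightarrow> real" and C
    using qm_class_mem_Hb2[OF assms(1), of u C] that unfolding trivial
    by (simp add: Hb2_def bounded_cohomology2_def)
  have "qm_class K \<phi> = qm_class K (\<lambda>_. 0)"
    using Hb2[of \<phi> B, OF B] Hb2[of "\<lambda>_. 0" 0] by simp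
  from qm_class_eqD[OF assms(1) this] obtain \<beta> C where \<beta>: "\<And>g. g \<in> carrier K \<Longrightarrow> \<bar>\<beta> g\<bar> \<le> C"
    and "\<And>g h. g \<in> carrier K \<Longrightarrow> h \<in> carrier K \<Longrightarrow>
      \<phi> (g \<otimes>\<^bsub>K\<^esub> h) - 0 - \<beta> (g \<otimes>\<^bsub>K\<^esub> h) = (\<phi> g - 0 - \<beta> g) + (\<phi> h - 0 - \<beta> h)" by metis
  then show thesis by (intro that[of "\<lambda>g. \<phi> g - \<beta> g" C]) auto
qed

section \<open>Torus coordinates\<close>

lemma additive_one:
  fixes \<tau> :: "'a \<Rightarrow> 'k::linordered_idom"
  assumes "group K" and add: "\<And>g h. g \<in> carrier K \<Longrightarrow> h \<in> carrier K \<Longrightarrow> \<tau> (g \<otimes>\<^bsub>K\<^esub> h) = \<tau> g + \<tau> h"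
  shows "\<tau> \<one>\<^bsub>K\<^esub> = 0"
proof -
  interpret group K by fact
  show ?thesis using add[of "\<one>\<^bsub>K\<^esub>" "\<one>\<^bsub>K\<^esub>"] by simp
qed

lemma additive_nat_pow:
  fixes \<tau> :: "'a \<Rightarrow> 'k::linordered_idom"
  assumes "group K" and add: "\<And>g h. g \<in> carrier K \<Longrightarrow> h \<in> carrier K \<Longrightarrow> \<tau> (g \<otimes>\<^bsub>K\<^esub> h) = \<tau> g + \<tau> h"
    and g: "g \<in> carrier K"
  shows "\<tau> (g [^]\<^bsub>K\<^esub> (n::nat)) = of_nat n * \<tau> g"
proof -
  interpret group K by fact
  show ?thesis
    by (induction n) (simp_all add: additive_one[OF assms(1), of \<tau>] add g algebra_simps)
qed

text \<open>The values on powers of \<open>g\<close> grow linearly unless the value at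
  \<open>g\<close> is zero.\<close>

lemma additive_bounded_eq_zero:
  fixes \<tau> :: "'a \<Rightarrow> real"
  assumes "group K" and add: "\<And>g h. g \<in> carrier K \<Longrightarrow> h \<in> carrier K \<Longrightarrow> \<tau> (g \<otimes>\<^bsub>K\<^esub> h) = \<tau> g + \<tau> h"
    and B: "\<And>g. g \<in> carrier K \<Longrightarrow> \<bar>\<tau> g\<bar> \<le> B" and g: "g \<in> carrier K"
  shows "\<tau> g = 0"
proof (rule ccontr)
  interpret group K by fact
  assume "\<tau> g \<noteq> 0"
  then obtain n :: nat where "B < of_nat n * \<bar>\<tau> g\<bar>"
    using reals_Archimedean3[of "\<bar>\<tau> g\<bar>"] by auto
  moreover have "\<bar>\<tau> (g [^]\<^bsub>K\<^esub> n)\<bar> \<le> B" using B g by simp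
  ultimately show False
    using additive_nat_pow[OF assms(1), of \<tau>, OF add g, of n] by (simp add: abs_mult)
qed

lemma mem_cohomology1_iff:
  fixes \<tau> :: "'a \<Rightarrow> 'b::linordered_idom"
  shows "\<tau> \<in> carrier (cohomology1 K) \<longleftrightarrow> \<tau> \<in> carrier K \<rightarrow>\<^sub>E UNIV \<and>
    (\<forall>g\<in>carrier K. \<forall>h\<in>carrier K. \<tau> (g \<otimes>\<^bsub>K\<^esub> h) = \<tau> g + \<tau> h)"
proof -
  \<comment> \<open>Writing the zero cochain as a coboundary makes \<open>coboundary1_eq_iff\<close>
    applicable.\<close>
  have "(\<lambda>t\<in>carrier K \<times> carrier K. 0) = coboundary1 K (\<lambda>_. 0 :: 'b)"
    by (auto simp: coboundary1_def intro!: restrict_ext)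
  then have "coboundary1 K \<tau> = (\<lambda>t\<in>carrier K \<times> carrier K. 0) \<longleftrightarrow> coboundary1 K \<tau> = coboundary1 K (\<lambda>_. 0)"
    by simp
  also have "\<dots> \<longleftrightarrow> (\<forall>g\<in>carrier K. \<forall>h\<in>carrier K. \<tau> (g \<otimes>\<^bsub>K\<^esub> h) = \<tau> g + \<tau> h)"
    unfolding coboundary1_eq_iff by (auto simp: algebra_simps)
  finally show ?thesis by (simp add: cohomology1_def kernel_def)
qed

text \<open>These are the elements of the quotient of real by integral first cohomology, with their
  members written as functions so that the choices in \<open>floor_iso\<close> and
  \<open>torus_coords\<close> can be evaluated.\<close>

definition integral_coset :: "('a, 'm) monoid_scheme \<Rightarrow> ('a \<Rightarrow> real) \<Rightarrow> ('a \<Rightarrow> real) set" where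
  "integral_coset K \<tau> = {\<lambda>h\<in>carrier K. real_of_int (\<sigma> h) + \<tau> h | \<sigma>. \<sigma> \<in> carrier (cohomology1 K)}"

lemma carrier_cohomology1_real_mod_int:
  "carrier (cohomology1_real_mod_int K) = integral_coset K ` carrier (cohomology1 K)"
proof -
  have "carrier (cohomology1_real_mod_int K) = (\<lambda>\<tau>. ((\<lambda>\<sigma>. \<lambda>h\<in>carrier K. real_of_int (\<sigma> h)) `
      carrier (cohomology1 K)) #>\<^bsub>cohomology1 K\<^esub> \<tau>) ` carrier (cohomology1 K)"
    by (simp add: cohomology1_real_mod_int_def carrier_FactGroup)
  also have "\<dots> = integral_coset K ` carrier (cohomology1 K)"
  proof (rule image_cong)
    fix \<tau> :: "'a \<Rightarrow> real"
    have "(\<lambda>h\<in>carrier K. real_of_int (\<sigma> h)) \<otimes>\<^bsub>cohomology1 K\<^esub> \<tau>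
        = (\<lambda>h\<in>carrier K. real_of_int (\<sigma> h) + \<tau> h)" for \<sigma>
      by (auto simp: cohomology1_def intro!: restrict_ext)
    then show "((\<lambda>\<sigma>. \<lambda>h\<in>carrier K. real_of_int (\<sigma> h)) ` carrier (cohomology1 K)) #>\<^bsub>cohomology1 K\<^esub> \<tau>
        = integral_coset K \<tau>"
      by (auto simp: r_coset_def integral_coset_def)
  qed simp
  finally show ?thesis .
qed

lemma self_mem_integral_coset:
  assumes "group K" and "\<tau> \<in> carrier (cohomology1 K)"
  shows "\<tau> \<in> integral_coset K \<tau>"
proof -
  interpret group K by fact
  have "\<tau> = (\<lambda>h\<in>carrier K. real_of_int ((\<lambda>t\<in>carrier K. 0) h) + \<tau> h)"
  proof (rule extensionalityI)
    show "\<tau> \<in> extensional (carrier K)" using assms(2) by (simp add: mem_cohomology1_iff PiE_def)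
  qed simp_all
  moreover have "(\<lambda>t\<in>carrier K. 0) \<in> carrier (cohomology1 K)" by (simp add: mem_cohomology1_iff)
  ultimately show ?thesis unfolding integral_coset_def by blast
qed

text \<open>Integers pass through the floor, so two representatives have floors that differ exactly
  by an integral homomorphism; hence the bound 0.\<close>

lemma floor_iso_integral_coset:
  assumes "group K" and "\<tau> \<in> carrier (cohomology1 K)"
  shows "floor_iso K (integral_coset K \<tau>) = qm_class K (\<lambda>h. \<lfloor>\<tau> h\<rfloor>)"
proof -
  have "qm_class K (\<lambda>h. \<lfloor>\<tau>' h\<rfloor>) = qm_class K (\<lambda>h. \<lfloor>\<tau> h\<rfloor>)" if mem: "\<tau>' \<in> integral_coset K \<tau>" for \<tau>'
  proof -
    obtain \<sigma> where \<sigma>: "\<sigma> \<in> carrier (cohomology1 K)" "\<tau>' = (\<lambda>h\<in>carrier K. real_of_int (\<sigma> h) + \<tau> h)"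
      using mem by (auto simp: integral_coset_def)
    show ?thesis
      by (rule qm_class_eqI[of K \<sigma> _ _ 0]) (use assms(1) \<sigma> in \<open>auto simp: mem_cohomology1_iff\<close>)
  qed
  then have "(\<lambda>\<tau>. qm_class K (\<lambda>h. \<lfloor>\<tau> h\<rfloor>)) ` integral_coset K \<tau> = {qm_class K (\<lambda>h. \<lfloor>\<tau> h\<rfloor>)}"
    using self_mem_integral_coset[OF assms] by blast
  then show ?thesis by (simp add: floor_iso_def)
qed

lemma torus_coords_integral_coset:
  assumes "group K" and "\<tau> \<in> carrier (cohomology1 K)" and y: "\<And>i. i < b \<Longrightarrow> y i \<in> carrier K"
  shows "torus_coords b y (integral_coset K \<tau>) = (\<lambda>i\<in>{..<b}. cis (2 * pi * \<tau> (y i)))"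
proof -
  have "(\<lambda>i\<in>{..<b}. cis (2 * pi * \<tau>' (y i))) = (\<lambda>i\<in>{..<b}. cis (2 * pi * \<tau> (y i)))"
    if mem: "\<tau>' \<in> integral_coset K \<tau>" for \<tau>'
  proof (rule restrict_ext)
    fix i assume "i \<in> {..<b}"
    moreover obtain \<sigma> where "\<tau>' = (\<lambda>h\<in>carrier K. real_of_int (\<sigma> h) + \<tau> h)"
      using mem by (auto simp: integral_coset_def)
    ultimately have "\<tau>' (y i) = real_of_int (\<sigma> (y i)) + \<tau> (y i)" using y by simp
    then have "cis (2 * pi * \<tau>' (y i)) = cis (2 * pi * real_of_int (\<sigma> (y i))) * cis (2 * pi * \<tau> (y i))"
      by (simp only: cis_mult distrib_left)
    then show "cis (2 * pi * \<tau>' (y i)) = cis (2 * pi * \<tau> (y i))"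
      by (simp only: cis_multiple_2pi Ints_of_int mult_1)
  qed
  then have "(\<lambda>\<tau>. \<lambda>i\<in>{..<b}. cis (2 * pi * \<tau> (y i))) ` integral_coset K \<tau>
      = {\<lambda>i\<in>{..<b}. cis (2 * pi * \<tau> (y i))}"
    using self_mem_integral_coset[OF assms(1,2)] by blast
  then show ?thesis by (simp add: torus_coords_def)
qed

text \<open>If two floors define the same class, they differ by an integral homomorphism
  \<open>\<delta>\<close> up to a bounded error. Then \<open>\<tau> - \<tau>' - \<delta>\<close> is
  a bounded real homomorphism, hence zero, and the cosets agree.\<close>

lemma inj_on_floor_iso:
  assumes "group K"
  shows "inj_on (floor_iso K) (carrier (cohomology1_real_mod_int K))"
proof -
  interpret group K by fact
  have sub: "integral_coset K \<tau> \<subseteq> integral_coset K \<tau>'"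
    if \<tau>: "\<tau> \<in> carrier (cohomology1 K)" and \<tau>': "\<tau>' \<in> carrier (cohomology1 K)"
      and eq: "qm_class K (\<lambda>h. \<lfloor>\<tau> h\<rfloor>) = qm_class K (\<lambda>h. \<lfloor>\<tau>' h\<rfloor>)" for \<tau> \<tau>'
  proof -
    obtain \<beta> B where \<beta>: "\<And>g. g \<in> carrier K \<Longrightarrow> \<bar>\<beta> g\<bar> \<le> B"
      and add: "\<And>g h. g \<in> carrier K \<Longrightarrow> h \<in> carrier K \<Longrightarrow>
        \<lfloor>\<tau> (g \<otimes>\<^bsub>K\<^esub> h)\<rfloor> - \<lfloor>\<tau>' (g \<otimes>\<^bsub>K\<^esub> h)\<rfloor> - \<beta> (g \<otimes>\<^bsub>K\<^esub> h)
          = (\<lfloor>\<tau> g\<rfloor> - \<lfloor>\<tau>' g\<rfloor> - \<beta> g) + (\<lfloor>\<tau> h\<rfloor> - \<lfloor>\<tau>' h\<rfloor> - \<beta> h)"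
      using qm_class_eqD[OF assms eq] by metis
    define \<delta> where "\<delta> = (\<lambda>g\<in>carrier K. \<lfloor>\<tau> g\<rfloor> - \<lfloor>\<tau>' g\<rfloor> - \<beta> g)"
    have \<delta>: "\<delta> \<in> carrier (cohomology1 K)"
      unfolding mem_cohomology1_iff using add by (simp add: \<delta>_def)
    have eq: "\<tau> g - \<tau>' g - real_of_int (\<delta> g) = 0" if "g \<in> carrier K" for g
    proof (rule additive_bounded_eq_zero[OF assms(1), of "\<lambda>g. \<tau> g - \<tau>' g - real_of_int (\<delta> g)"])
      fix g assume "g \<in> carrier K"
      with \<beta>[of g] have "real_of_int \<bar>\<beta> g\<bar> \<le> real_of_int B" by (simp only: of_int_le_iff)
      \<comment> \<open>The two fractional parts contribute at most 1, the correction
        \<open>\<beta>\<close> at most \<open>B\<close>.\<close>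
      then show "\<bar>\<tau> g - \<tau>' g - real_of_int (\<delta> g)\<bar> \<le> 1 + real_of_int B"
        using \<open>g \<in> carrier K\<close> floor_correct[of "\<tau> g"] floor_correct[of "\<tau>' g"] by (simp add: \<delta>_def) linarith
    qed (use \<tau> \<tau>' \<delta> that in \<open>auto simp: mem_cohomology1_iff\<close>)
    show ?thesis
    proof
      fix f assume "f \<in> integral_coset K \<tau>"
      then obtain \<sigma> where \<sigma>: "\<sigma> \<in> carrier (cohomology1 K)" "f = (\<lambda>h\<in>carrier K. real_of_int (\<sigma> h) + \<tau> h)"
        by (auto simp: integral_coset_def)
      have "(\<lambda>h\<in>carrier K. \<sigma> h + \<delta> h) \<in> carrier (cohomology1 K)"
        using \<sigma>(1) \<delta> by (auto simp: mem_cohomology1_iff)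
      moreover have "f = (\<lambda>h\<in>carrier K. real_of_int ((\<lambda>h\<in>carrier K. \<sigma> h + \<delta> h) h) + \<tau>' h)"
        unfolding \<sigma>(2)
      proof (rule restrict_ext)
        fix h assume "h \<in> carrier K"
        then show "real_of_int (\<sigma> h) + \<tau> h = real_of_int ((\<lambda>h\<in>carrier K. \<sigma> h + \<delta> h) h) + \<tau>' h"
          using eq[of h] by simp
      qed
      ultimately show "f \<in> integral_coset K \<tau>'" unfolding integral_coset_def by blast
    qed
  qed
  show ?thesis
    unfolding carrier_cohomology1_real_mod_int inj_on_def
    using sub by (auto simp: floor_iso_integral_coset[OF assms])
qed

text \<open>This computes the chart that defines \<open>Hb2_topology\<close>: by injectivity,
  \<open>inv_into\<close> recovers the integral coset of \<open>\<tau>\<close>.\<close>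

lemma Hb2_coordinates_floor:
  assumes "group K" and y: "\<And>i. i < b \<Longrightarrow> y i \<in> carrier K"
    and add: "\<And>g h. g \<in> carrier K \<Longrightarrow> h \<in> carrier K \<Longrightarrow> \<tau> (g \<otimes>\<^bsub>K\<^esub> h) = \<tau> g + \<tau> h"
  shows "(torus_coords b y \<circ> inv_into (carrier (cohomology1_real_mod_int K)) (floor_iso K))
      (qm_class K (\<lambda>h. \<lfloor>\<tau> h\<rfloor>)) = (\<lambda>i\<in>{..<b}. cis (2 * pi * \<tau> (y i)))"
proof -
  interpret group K by fact
  \<comment> \<open>Cochains are extensional, so only the restriction of \<open>\<tau>\<close> is a
    member of \<open>cohomology1 K\<close>.\<close>
  let ?\<tau> = "restrict \<tau> (carrier K)"
  have \<tau>: "?\<tau> \<in> carrier (cohomology1 K)" using add by (simp add: mem_cohomology1_iff)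
  have "qm_class K (\<lambda>h. \<lfloor>\<tau> h\<rfloor>) = qm_class K (\<lambda>h. \<lfloor>?\<tau> h\<rfloor>)"
    by (rule qm_class_eqI[of K "\<lambda>_. 0" _ _ 0]) (use assms(1) in auto)
  also have "\<dots> = floor_iso K (integral_coset K ?\<tau>)"
    using floor_iso_integral_coset[OF assms(1) \<tau>] by simp
  finally have eq: "qm_class K (\<lambda>h. \<lfloor>\<tau> h\<rfloor>) = floor_iso K (integral_coset K ?\<tau>)" .
  have "integral_coset K ?\<tau> \<in> carrier (cohomology1_real_mod_int K)"
    using \<tau> by (simp add: carrier_cohomology1_real_mod_int)
  then have "inv_into (carrier (cohomology1_real_mod_int K)) (floor_iso K) (qm_class K (\<lambda>h. \<lfloor>\<tau> h\<rfloor>))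
      = integral_coset K ?\<tau>"
    unfolding eq by (rule inv_into_f_f[OF inj_on_floor_iso[OF assms(1)]])
  then show ?thesis
    using torus_coords_integral_coset[OF assms(1) \<tau>, of b y] y by (auto intro!: restrict_ext)
qed

section \<open>Homomorphisms and first homology\<close>

text \<open>Writing the additive group as a monoid record makes the universal property of factor
  groups available for real homomorphisms.\<close>

definition additive_reals :: "real monoid" where
  "additive_reals = \<lparr>carrier = UNIV, monoid.mult = (+), one = 0\<rparr>"

lemma group_additive_reals: "group additive_reals"
  by (rule groupI) (auto simp: additive_reals_def add.assoc intro: exI[of _ "- _"])

lemma group_hom_additive_reals:
  "group K \<Longrightarrow> \<tau> \<in> hom K additive_reals \<Longrightarrow> group_hom K additive_reals \<tau>"
  by (simp add: group_hom_def group_hom_axioms_def group_additive_reals)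

lemma one_additive_reals: "\<one>\<^bsub>additive_reals\<^esub> = 0"
  by (simp add: additive_reals_def)

lemma inv_additive_reals: "inv\<^bsub>additive_reals\<^esub> t = - t"
  using group.inv_equality[OF group_additive_reals, of "- t" t] by (simp add: additive_reals_def)

lemma nat_pow_additive_reals: "t [^]\<^bsub>additive_reals\<^esub> (n::nat) = of_nat n * t"
  by (induction n) (simp_all add: nat_pow_def additive_reals_def algebra_simps)

lemma int_pow_additive_reals: "t [^]\<^bsub>additive_reals\<^esub> (n::int) = of_int n * t"
  by (auto simp: int_pow_def2 nat_pow_additive_reals inv_additive_reals)

lemma subgroup_torsion_subgroup:
  assumes "comm_group A"
  shows "subgroup (torsion_subgroup A) A"
proof -
  interpret comm_group A by fact
  show ?thesis
  proof (rule subgroupI)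
    fix a assume "a \<in> torsion_subgroup A"
    then show "inv\<^bsub>A\<^esub> a \<in> torsion_subgroup A"
      by (auto simp: torsion_subgroup_def nat_pow_inv)
  next
    fix a c assume "a \<in> torsion_subgroup A" "c \<in> torsion_subgroup A"
    then obtain m n :: nat where "a \<in> carrier A" "c \<in> carrier A" "m > 0" "n > 0"
      and "a [^]\<^bsub>A\<^esub> m = \<one>\<^bsub>A\<^esub>" "c [^]\<^bsub>A\<^esub> n = \<one>\<^bsub>A\<^esub>"
      by (auto simp: torsion_subgroup_def)
    moreover from this have "(a \<otimes>\<^bsub>A\<^esub> c) [^]\<^bsub>A\<^esub> (m * n) = \<one>\<^bsub>A\<^esub>"
    proof -
      have "a [^]\<^bsub>A\<^esub> (m * n) = \<one>\<^bsub>A\<^esub>" "c [^]\<^bsub>A\<^esub> (n * m) = \<one>\<^bsub>A\<^esub>"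
        using calculation nat_pow_pow[of a m n, symmetric] nat_pow_pow[of c n m, symmetric]
        by simp_all
      then show ?thesis using calculation by (simp add: nat_pow_distrib mult.commute[of n m])
    qed
    ultimately show "a \<otimes>\<^bsub>A\<^esub> c \<in> torsion_subgroup A"
      unfolding torsion_subgroup_def by (auto intro!: exI[of _ "m * n"])
  next
    show "torsion_subgroup A \<noteq> {}"
      by (auto simp: torsion_subgroup_def intro!: exI[of _ "\<one>\<^bsub>A\<^esub>"] exI[of _ "1::nat"])
  qed (auto simp: torsion_subgroup_def)
qed

text \<open>A real homomorphism kills commutators and torsion, so it factors through first homology
  modulo torsion, where the class of \<open>a\<close> is an integer combination of the basis. The
  coefficients are fixed before \<open>\<tau>\<close>, hence serve for all orderings at
  once.\<close>

lemma homology1_basis_additive: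
  assumes "group K" and basis: "homology1_basis K b y" and a: "a \<in> carrier K"
  obtains n :: "nat \<Rightarrow> int" where
    "\<And>\<tau> :: 'a \<Rightarrow> real. (\<And>g h. g \<in> carrier K \<Longrightarrow> h \<in> carrier K \<Longrightarrow> \<tau> (g \<otimes>\<^bsub>K\<^esub> h) = \<tau> g + \<tau> h) \<Longrightarrow>
      \<tau> a = (\<Sum>i<b. of_int (n i) * \<tau> (y i))"
proof -
  interpret K: group K by fact
  define A where "A = homology1 K"
  define F where "F = homology1_free K"
  define D where "D = derived K (carrier K)"
  define T where "T = torsion_subgroup A"
  have D: "D \<lhd> K" unfolding D_def by (rule K.derived_self_is_normal)
  have A_eq: "A = K Mod D" by (simp add: A_def D_def homology1_def)
  have F_eq: "F = A Mod T" by (simp add: F_def A_def T_def homology1_free_def)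
  interpret A: comm_group A
    unfolding A_eq D_def by (rule K.derived_quot_is_comm_group)
  have "subgroup T A" unfolding T_def by (rule subgroup_torsion_subgroup) unfold_locales
  then have T: "T \<lhd> A" by (rule A.subgroup_imp_normal)
  interpret F: comm_group F
    unfolding F_eq by (rule A.abelian_FactGroup) fact
  have cls_mem: "homology1_class K g \<in> carrier F" if "g \<in> carrier K" for g
    using that by (auto simp: homology1_class_def F_eq A_eq T_def carrier_FactGroup A_def homology1_def D_def)
  have y: "y i \<in> carrier K" if "i < b" for i
    using basis that by (simp add: homology1_basis_def)
  obtain n where n: "homology1_class K a = finprod F (\<lambda>i. homology1_class K (y i) [^]\<^bsub>F\<^esub> (n i :: int)) {..<b}"
    using basis cls_mem[OF a] unfolding homology1_basis_def F_def by blast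
  show thesis
  proof (rule that)
    fix \<tau> :: "'a \<Rightarrow> real"
    assume add: "\<And>g h. g \<in> carrier K \<Longrightarrow> h \<in> carrier K \<Longrightarrow> \<tau> (g \<otimes>\<^bsub>K\<^esub> h) = \<tau> g + \<tau> h"
    have hom: "\<tau> \<in> hom K additive_reals"
      using add by (auto simp: hom_def additive_reals_def)
    interpret \<tau>: group_hom K additive_reals \<tau>
      by (rule group_hom_additive_reals[OF assms(1) hom])
    have \<tau>_inv: "\<tau> (inv\<^bsub>K\<^esub> g) = - \<tau> g" if "g \<in> carrier K" for g
      using \<tau>.hom_inv[OF that] by (simp add: inv_additive_reals)
    have "D \<subseteq> kernel K additive_reals \<tau>"
      unfolding D_def derived_def
      by (rule K.generate_subgroup_incl[OF _ \<tau>.subgroup_kernel])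
        (auto simp: kernel_def add \<tau>_inv one_additive_reals simp del: \<tau>.hom_inv \<tau>.hom_mult)
    then obtain \<tau>1 where \<tau>1: "\<tau>1 \<in> hom A additive_reals" "\<And>g. g \<in> carrier K \<Longrightarrow> \<tau>1 (D #>\<^bsub>K\<^esub> g) = \<tau> g"
      using \<tau>.FactGroup_universal_kernel[OF D] unfolding A_eq by metis
    interpret \<tau>1: group_hom A additive_reals \<tau>1
      by (rule group_hom_additive_reals[OF A.is_group \<tau>1(1)])
    \<comment> \<open>Torsion dies because a positive multiple of a real number vanishes only if the
      number does.\<close>
    have "T \<subseteq> kernel A additive_reals \<tau>1"
    proof
      fix c assume "c \<in> T"
      then obtain k :: nat where c: "c \<in> carrier A" and k: "k > 0" "c [^]\<^bsub>A\<^esub> k = \<one>\<^bsub>A\<^esub>"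
        by (auto simp: T_def torsion_subgroup_def)
      have "real k * \<tau>1 c = \<tau>1 (c [^]\<^bsub>A\<^esub> k)"
        using \<tau>1.hom_nat_pow[OF c, of k] by (simp add: nat_pow_additive_reals)
      also have "\<dots> = 0" unfolding k(2) using \<tau>1.hom_one by (simp add: additive_reals_def)
      finally show "c \<in> kernel A additive_reals \<tau>1" using k c by (simp add: kernel_def additive_reals_def)
    qed
    then obtain \<tau>2 where \<tau>2: "\<tau>2 \<in> hom F additive_reals" "\<And>c. c \<in> carrier A \<Longrightarrow> \<tau>2 (T #>\<^bsub>A\<^esub> c) = \<tau>1 c"
      using \<tau>1.FactGroup_universal_kernel[OF T] unfolding F_eq by metis
    interpret \<tau>2: group_hom F additive_reals \<tau>2
      by (rule group_hom_additive_reals[OF F.is_group \<tau>2(1)])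
    have cls: "\<tau>2 (homology1_class K g) = \<tau> g" if "g \<in> carrier K" for g
    proof -
      have "D #>\<^bsub>K\<^esub> g \<in> carrier A" using that by (auto simp: A_eq carrier_FactGroup)
      then have "\<tau>2 (T #>\<^bsub>A\<^esub> (D #>\<^bsub>K\<^esub> g)) = \<tau> g" using \<tau>2(2) \<tau>1(2)[OF that] by simp
      then show ?thesis by (simp add: homology1_class_def T_def A_def D_def)
    qed
    \<comment> \<open>The claim is generalized to subsets of the index set to permit induction over
      finite sets.\<close>
    have "\<tau>2 (finprod F (\<lambda>i. homology1_class K (y i) [^]\<^bsub>F\<^esub> n i) I) = (\<Sum>i\<in>I. of_int (n i) * \<tau> (y i))"
      if "finite I" "I \<subseteq> {..<b}" for I
      using that
    proof (induction I rule: finite_induct)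
      case empty
      then show ?case using \<tau>2.hom_one by (simp add: additive_reals_def)
    next
      case (insert j I)
      let ?f = "\<lambda>i. homology1_class K (y i) [^]\<^bsub>F\<^esub> n i"
      have f: "?f i \<in> carrier F" if "i < b" for i
        using that y cls_mem by simp
      have "\<tau>2 (?f j) = of_int (n j) * \<tau> (y j)"
        using insert.prems y cls_mem cls \<tau>2.hom_int_pow by (simp add: int_pow_additive_reals)
      moreover have "finprod F ?f (insert j I) = ?f j \<otimes>\<^bsub>F\<^esub> finprod F ?f I"
        using insert f by (intro F.finprod_insert) (auto simp: subset_iff)
      moreover have "\<tau>2 (?f j \<otimes>\<^bsub>F\<^esub> finprod F ?f I) = \<tau>2 (?f j) + \<tau>2 (finprod F ?f I)"
      proof -
        have "?f j \<in> carrier F" "finprod F ?f I \<in> carrier F"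
          using insert f by (auto simp: subset_iff intro!: F.finprod_closed)
        then show ?thesis using \<tau>2.hom_mult by (simp add: additive_reals_def)
      qed
      ultimately show ?case using insert by simp
    qed
    from this[of "{..<b}"] show "\<tau> a = (\<Sum>i<b. of_int (n i) * \<tau> (y i))"
      using cls[OF a] n by simp
  qed
qed

section \<open>Translation by a positive element\<close>

text \<open>The relation is kept abstract so that an ordering with \<open>x\<close> positive and the
  reverse of one with \<open>x\<close> negative are treated alike. Right invariance is limited to
  \<open>x\<close> and to the subgroup generated by \<open>x\<close> and \<open>H\<close>.\<close>

locale invariant_order = group G for G (structure) +
  fixes x :: 'a and H :: "'a set" and less :: "'a \<Rightarrow> 'a \<Rightarrow> bool" (infix "\<lless>" 50)
  assumes x_closed [simp]: "x \<in> carrier G"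
    and subgroup_H: "subgroup H G"
    and less_irrefl: "a \<in> carrier G \<Longrightarrow> \<not> a \<lless> a"
    and less_trans: "a \<in> carrier G \<Longrightarrow> b \<in> carrier G \<Longrightarrow> c \<in> carrier G \<Longrightarrow> a \<lless> b \<Longrightarrow> b \<lless> c \<Longrightarrow> a \<lless> c"
    and less_total: "a \<in> carrier G \<Longrightarrow> b \<in> carrier G \<Longrightarrow> a \<noteq> b \<Longrightarrow> a \<lless> b \<or> b \<lless> a"
    and less_left: "a \<in> carrier G \<Longrightarrow> b \<in> carrier G \<Longrightarrow> c \<in> carrier G \<Longrightarrow> a \<lless> b \<Longrightarrow> c \<otimes> a \<lless> c \<otimes> b"
    and less_right: "a \<in> generate G (insert x H) \<Longrightarrow> b \<in> generate G (insert x H) \<Longrightarrow>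
      a \<lless> b \<Longrightarrow> a \<otimes> x \<lless> b \<otimes> x"
    and x_pos: "\<one> \<lless> x"
begin

abbreviation le (infix "\<preceq>" 50) where "a \<preceq> b \<equiv> a \<lless> b \<or> a = b"

abbreviation "K \<equiv> generate G (insert x H)"

text \<open>The relational form of the value of \<open>\<rho>\<close>, free of the definite
  description in \<open>rho\<close>.\<close>

definition bracket :: "'a \<Rightarrow> int \<Rightarrow> bool" where
  "bracket h N \<longleftrightarrow> x [^] N \<preceq> h \<and> h \<lless> x [^] (N + 1)"

definition cofinal :: "'a \<Rightarrow> bool" where
  "cofinal a \<longleftrightarrow> (\<exists>N::int. x [^] (- N) \<lless> a \<and> a \<lless> x [^] N)"

lemma H_closed [simp]: "h \<in> H \<Longrightarrow> h \<in> carrier G"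
  using subgroup_H by (auto dest: subgroup.mem_carrier)

lemma subgroup_K: "subgroup K G"
  using subgroup_H subgroup.subset by (intro generate_is_subgroup) auto

lemma K_closed [simp]: "h \<in> K \<Longrightarrow> h \<in> carrier G"
  using subgroup_K by (auto dest: subgroup.mem_carrier)

lemma H_K: "h \<in> H \<Longrightarrow> h \<in> K"
  by (auto intro: generate.incl)

lemma pow_K [simp]: "x [^] (n::int) \<in> K"
proof -
  have "x \<in> K" by (auto intro: generate.incl)
  then show ?thesis using subgroup_int_pow_closed[OF subgroup_K] by blast
qed

lemma mult_K [simp]: "a \<in> K \<Longrightarrow> b \<in> K \<Longrightarrow> a \<otimes> b \<in> K"
  using subgroup_K by (rule subgroup.m_closed)

lemma le_less_trans: "a \<in> carrier G \<Longrightarrow> b \<in> carrier G \<Longrightarrow> c \<in> carrier G \<Longrightarrow> a \<preceq> b \<Longrightarrow> b \<lless> c \<Longrightarrow> a \<lless> c"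
  using less_trans by blast

lemma le_iff_not_less: "a \<in> carrier G \<Longrightarrow> b \<in> carrier G \<Longrightarrow> a \<preceq> b \<longleftrightarrow> \<not> b \<lless> a"
  using less_trans less_irrefl less_total by blast

lemma pow_less_Suc: "x [^] (n::int) \<lless> x [^] (n + 1)"
  using less_left[OF _ _ _ x_pos, of "x [^] n"] by (simp add: int_pow_mult)

lemma pow_less: "(m::int) < n \<Longrightarrow> x [^] m \<lless> x [^] n"
proof (induction n rule: int_gr_induct)
  case base
  show ?case by (rule pow_less_Suc)
next
  case (step i)
  then show ?case using less_trans[OF _ _ _ _ pow_less_Suc] by auto
qed

lemma pow_le: "(m::int) \<le> n \<Longrightarrow> x [^] m \<preceq> x [^] n"
  using pow_less[of m n] by (cases "m = n") auto

lemma pow_less_iff: "x [^] (m::int) \<lless> x [^] n \<longleftrightarrow> m < n"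
  using pow_less[of m n] pow_le[of n m] le_iff_not_less[of "x [^] n" "x [^] m"] by fastforce

text \<open>By totality, a failure would give the reverse comparison, and multiplying it by
  \<open>x\<close> contradicts the hypothesis.\<close>

lemma less_right_inv:
  assumes "a \<in> K" "b \<in> K" "a \<lless> b" shows "a \<otimes> inv x \<lless> b \<otimes> inv x"
proof (rule ccontr)
  have K: "a \<otimes> inv x \<in> K" "b \<otimes> inv x \<in> K"
    using assms pow_K[of "-1"] by (simp_all add: int_pow_neg)
  assume "\<not> a \<otimes> inv x \<lless> b \<otimes> inv x"
  then have "b \<otimes> inv x \<preceq> a \<otimes> inv x"
    using K by (simp add: le_iff_not_less)
  then have "b \<otimes> inv x \<otimes> x \<preceq> a \<otimes> inv x \<otimes> x"
    using less_right[OF K(2,1)] by auto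
  then have "b \<preceq> a" using assms by (simp add: m_assoc)
  then show False using assms le_iff_not_less by simp
qed

lemma less_right_pow:
  assumes "a \<in> K" "b \<in> K" "a \<lless> b" shows "a \<otimes> x [^] (n::int) \<lless> b \<otimes> x [^] n"
proof (induction n rule: int_induct[where k = 0])
  case base
  then show ?case using assms by simp
next
  case (step1 i)
  then have "a \<otimes> x [^] i \<otimes> x \<lless> b \<otimes> x [^] i \<otimes> x" using assms less_right by simp
  then show ?case using assms by (simp add: m_assoc int_pow_mult)
next
  case (step2 i)
  then have "a \<otimes> x [^] i \<otimes> inv x \<lless> b \<otimes> x [^] i \<otimes> inv x" using assms less_right_inv by simp
  then show ?case using assms by (simp add: m_assoc int_pow_diff)
qed

lemma le_right_pow:
  assumes "a \<in> K" "b \<in> K" "a \<preceq> b" shows "a \<otimes> x [^] (n::int) \<preceq> b \<otimes> x [^] n"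
  using assms less_right_pow by auto

lemma bracket_unique:
  assumes "h \<in> carrier G" "bracket h M" "bracket h N" shows "M = N"
proof -
  have "x [^] M \<lless> x [^] (N + 1)" "x [^] N \<lless> x [^] (M + 1)"
    by (rule le_less_trans[of _ h]; use assms in \<open>simp add: bracket_def\<close>)+
  then show ?thesis by (simp add: pow_less_iff)
qed

lemma bracket_le:
  assumes "h \<in> carrier G" "bracket h N" "x [^] n \<preceq> h" shows "n \<le> N"
proof -
  have "x [^] n \<lless> x [^] (N + 1)"
    by (rule le_less_trans[of _ h]; use assms in \<open>simp add: bracket_def\<close>)
  then show ?thesis by (simp add: pow_less_iff)
qed

text \<open>Without a bracket, the lower bound by a power of \<open>x\<close> climbs one exponent at
  a time and passes the upper bound.\<close>

lemma bracket_exists: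
  assumes a: "a \<in> carrier G" and lo: "x [^] (M::int) \<preceq> a" and hi: "a \<lless> x [^] (N::int)"
  shows "\<exists>n. bracket a n"
proof (rule ccontr)
  assume no: "\<nexists>n. bracket a n"
  have "x [^] n \<preceq> a" if "M \<le> n" for n
    using that
  proof (induction n rule: int_ge_induct)
    case (step i)
    then have "\<not> a \<lless> x [^] (i + 1)" using no by (auto simp: bracket_def)
    then show ?case using a le_iff_not_less by simp
  qed (fact lo)
  from this[of "max M N"] have "x [^] max M N \<lless> x [^] N"
    using le_less_trans[of "x [^] max M N" a "x [^] N"] hi a by simp
  then show False by (simp add: pow_less_iff)
qed

text \<open>The product is compared with \<open>g\<close> times a power of \<open>x\<close> by left
  invariance, and that with a pure power of \<open>x\<close> by right invariance.\<close>

lemma bracket_mult: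
  assumes g: "g \<in> H" "bracket g M" and h: "h \<in> H" "bracket h N"
  shows "x [^] (M + N) \<preceq> g \<otimes> h" and "g \<otimes> h \<lless> x [^] (M + N + 2)"
proof -
  have K: "g \<in> K" "h \<in> K" using g h H_K by auto
  have "x [^] M \<otimes> x [^] N \<preceq> g \<otimes> x [^] N"
    using g K by (intro le_right_pow) (auto simp: bracket_def)
  moreover have "g \<otimes> x [^] N \<preceq> g \<otimes> h"
    using h K less_left by (auto simp: bracket_def)
  moreover have "x [^] M \<otimes> x [^] N = x [^] (M + N)" by (simp add: int_pow_mult)
  ultimately show "x [^] (M + N) \<preceq> g \<otimes> h"
    using less_trans[of "x [^] (M + N)" "g \<otimes> x [^] N" "g \<otimes> h"] K by auto
  have "g \<otimes> h \<lless> g \<otimes> x [^] (N + 1)"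
    using h K less_left by (auto simp: bracket_def)
  moreover have "g \<otimes> x [^] (N + 1) \<lless> x [^] (M + 1) \<otimes> x [^] (N + 1)"
    using g K by (intro less_right_pow) (auto simp: bracket_def)
  moreover have "x [^] (M + 1) \<otimes> x [^] (N + 1) = x [^] (M + N + 2)"
    using int_pow_mult[of x "M + 1" "N + 1"] by (simp add: algebra_simps)
  ultimately show "g \<otimes> h \<lless> x [^] (M + N + 2)"
    using less_trans[of "g \<otimes> h" "g \<otimes> x [^] (N + 1)" "x [^] (M + N + 2)"] K by auto
qed

text \<open>The upper estimate in \<open>bracket_mult\<close> is strict, so the exponent
  \<open>M + N + 2\<close> is excluded and the defect is 0 or 1.\<close>

lemma bracket_mult_defect:
  assumes "g \<in> H" "bracket g M" "h \<in> H" "bracket h N" "bracket (g \<otimes> h) L"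
  shows "M + N \<le> L" and "L \<le> M + N + 1"
proof -
  show "M + N \<le> L"
    using bracket_le[of "g \<otimes> h" L "M + N"] bracket_mult(1)[OF assms(1-4)] assms by simp
  have "x [^] L \<lless> x [^] (M + N + 2)"
    by (rule le_less_trans[of _ "g \<otimes> h"])
      (use bracket_mult(2)[OF assms(1-4)] assms in \<open>simp_all add: bracket_def\<close>)
  then show "L \<le> M + N + 1" by (simp add: pow_less_iff)
qed

text \<open>Left multiplication by the inverse of \<open>a\<close> and right multiplication by a
  power of \<open>x\<close> both preserve the order; a general left ordering has no such rule for
  inverses.\<close>

lemma inv_less_pow:
  assumes "a \<in> K" "x [^] (n::int) \<lless> a" shows "inv a \<lless> x [^] (- n)"
proof -
  have ia: "inv a \<in> K" using assms subgroup_K by (simp add: subgroup.m_inv_closed)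
  have "inv a \<otimes> x [^] n \<lless> inv a \<otimes> a" using assms ia by (intro less_left) auto
  then have "inv a \<otimes> x [^] n \<otimes> x [^] (- n) \<lless> \<one> \<otimes> x [^] (- n)"
    using assms ia by (intro less_right_pow) (auto intro: generate.one)
  then show ?thesis using assms by (simp add: m_assoc int_pow_mult[symmetric])
qed

lemma pow_less_inv:
  assumes "a \<in> K" "a \<lless> x [^] (n::int)" shows "x [^] (- n) \<lless> inv a"
proof -
  have ia: "inv a \<in> K" using assms subgroup_K by (simp add: subgroup.m_inv_closed)
  have "inv a \<otimes> a \<lless> inv a \<otimes> x [^] n" using assms ia by (intro less_left) auto
  then have "\<one> \<otimes> x [^] (- n) \<lless> inv a \<otimes> x [^] n \<otimes> x [^] (- n)"
    using assms ia by (intro less_right_pow) (auto intro: generate.one)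
  then show ?thesis using assms by (simp add: m_assoc int_pow_mult[symmetric])
qed

section \<open>Cofinality of \<open>x\<close> and its failure\<close>

lemma cofinal_iff_bracket:
  assumes "a \<in> carrier G"
  shows "cofinal a \<longleftrightarrow> (\<exists>N. bracket a N)"
proof
  assume "cofinal a"
  then show "\<exists>N. bracket a N" using bracket_exists[OF assms] unfolding cofinal_def by blast
next
  assume "\<exists>N. bracket a N"
  then obtain N :: int where N: "x [^] N \<preceq> a" "a \<lless> x [^] (N + 1)" unfolding bracket_def by blast
  \<comment> \<open>One exponent must work on both sides: its negative lies strictly below
    \<open>N\<close>, and it is at least \<open>N + 1\<close>.\<close>
  let ?n = "\<bar>N\<bar> + 1"
  have "x [^] (- ?n) \<lless> x [^] N" by (rule pow_less) linarith
  then have "x [^] (- ?n) \<lless> a" using N(1) less_trans[of "x [^] (- ?n)" "x [^] N" a] assms by auto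
  moreover have "x [^] (N + 1) \<preceq> x [^] ?n" by (rule pow_le) linarith
  then have "a \<lless> x [^] ?n"
    using N(2) less_trans[of a "x [^] (N + 1)" "x [^] ?n"] assms by auto
  ultimately show "cofinal a" unfolding cofinal_def by blast
qed

lemma cofinal_one: "cofinal \<one>"
  using pow_less[of "-1" 0] pow_less[of 0 1] unfolding cofinal_def by (intro exI[of _ 1]) simp

lemma cofinal_mult:
  assumes "g \<in> H" "h \<in> H" "cofinal g" "cofinal h" shows "cofinal (g \<otimes> h)"
proof -
  obtain M N where "bracket g M" "bracket h N"
    using assms by (auto simp: cofinal_iff_bracket)
  then show ?thesis using bracket_mult[of g M h N] bracket_exists[of "g \<otimes> h"] assms
    by (auto simp: cofinal_iff_bracket)
qed

lemma cofinal_inv: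
  assumes "h \<in> H" "cofinal h" shows "cofinal (inv h)"
proof -
  obtain N :: int where "x [^] (- N) \<lless> h" "h \<lless> x [^] N"
    using assms unfolding cofinal_def by blast
  then have "inv h \<lless> x [^] N" "x [^] (- N) \<lless> inv h"
    using inv_less_pow[of h "- N"] pow_less_inv[of h N] assms H_K by simp_all
  then show ?thesis unfolding cofinal_def by blast
qed

text \<open>Elements of \<open>H\<close> bounded by powers of \<open>x\<close> are closed under
  products and inverses. With finitely many generators, cofinality becomes a finite intersection of
  conditions.\<close>

lemma cofinal_generate:
  assumes "generate G S = H" "\<And>s. s \<in> S \<Longrightarrow> cofinal s" "h \<in> H"
  shows "cofinal h"
proof -
  have S: "S \<subseteq> H" using assms(1) by (auto intro: generate.incl)
  \<comment> \<open>Membership in \<open>H\<close> is carried along because closure under products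
    is available only there.\<close>
  have "h \<in> H \<and> cofinal h" if "h \<in> generate G S"
    using that
  proof induction
    case one
    then show ?case using subgroup_H cofinal_one by (simp add: subgroup.one_closed)
  next
    case (incl h)
    then show ?case using S assms(2) by auto
  next
    case (inv h)
    then show ?case using S assms(2) cofinal_inv subgroup_H by (auto intro: subgroup.m_inv_closed)
  next
    case (eng g h)
    then show ?case using cofinal_mult subgroup_H by (auto intro: subgroup.m_closed)
  qed
  then show ?thesis using assms by simp
qed

text \<open>No two powers of \<open>x\<close> enclose \<open>a\<close>, so by totality
  \<open>a\<close> lies above all powers or below all of them; in the second case its inverse lies
  above all.\<close>

lemma not_cofinal_unbounded:
  assumes a: "a \<in> H" and "\<not> cofinal a"
  obtains c where "c \<in> H" "\<And>n::int. x [^] n \<lless> c"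
proof -
  have a_closed: "a \<in> carrier G" using a by simp
  have no: "\<not> (x [^] M \<lless> a \<and> a \<lless> x [^] N)" for M N :: int
    using assms(2) bracket_exists[OF a_closed, of M N] cofinal_iff_bracket[OF a_closed] by auto
  show thesis
  proof (cases "\<exists>M::int. x [^] M \<lless> a")
    case True
    then have "\<not> a \<lless> x [^] n" for n :: int using no by blast
    \<comment> \<open>Totality only gives weak inequalities; one spare exponent makes them
      strict.\<close>
    then have "x [^] (n + 1) \<preceq> a" for n :: int using le_iff_not_less a_closed by simp
    then have "x [^] n \<lless> a" for n :: int
      using pow_less_Suc[of n] less_trans[of "x [^] n" "x [^] (n + 1)" a] a_closed by auto
    then show thesis using that a by blast
  next
    case False
    then have "a \<preceq> x [^] (n - 1)" for n :: int
      using le_iff_not_less[of a "x [^] (n - 1)"] a_closed by auto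
    then have "a \<lless> x [^] n" for n :: int
      using pow_less[of "n - 1" n] le_less_trans[of a "x [^] (n - 1)" "x [^] n"] a_closed by auto
    then have "x [^] n \<lless> inv a" for n :: int
      using pow_less_inv[of a "- n"] a H_K by simp
    then show thesis using that a subgroup_H by (auto intro: subgroup.m_inv_closed)
  qed
qed

end

section \<open>Homogenization of almost additive integer sequences\<close>

text \<open>Between \<open>f (k * m)\<close> and \<open>k\<close> times \<open>f m\<close> the error
  stays below \<open>k\<close>, so the ratios at \<open>k * m\<close> and \<open>m\<close> differ by
  at most \<open>1 / m\<close>, whatever \<open>k\<close> is. Convergence and the explicit rate both
  follow.\<close>

lemma superadditive_ratio:
  fixes f :: "nat \<Rightarrow> int"
  assumes f: "\<And>m n. f m + f n \<le> f (m + n)" "\<And>m n. f (m + n) \<le> f m + f n + 1" and m: "m > 0"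
  shows "\<bar>lim (\<lambda>n. real_of_int (f n) / real n) - real_of_int (f m) / real m\<bar> \<le> 1 / real m"
    and "convergent (\<lambda>n. real_of_int (f n) / real n)"
proof -
  have mult: "int k * f m \<le> f (k * m) \<and> f (k * m) \<le> int k * f m + int k - 1" if "k > 0" for k m
    using that
  proof (induction k rule: nat_induct_non_zero)
    case (Suc k)
    have "f (Suc k * m) = f (m + k * m)" by simp
    then show ?case using Suc f(1)[of m "k * m"] f(2)[of m "k * m"] by (simp add: algebra_simps)
  qed simp
  let ?r = "\<lambda>n. real_of_int (f n) / real n"
  have near: "\<bar>?r (k * m) - ?r m\<bar> \<le> 1 / real m" if "k > 0" "m > 0" for k m
  proof -
    have "real_of_int (int k * f m) \<le> real_of_int (f (k * m))"
      "real_of_int (f (k * m)) \<le> real_of_int (int k * f m + int k - 1)"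
      using mult[OF that(1), of m] by (simp_all only: of_int_le_iff)
    then have "\<bar>real_of_int (f (k * m)) - real k * real_of_int (f m)\<bar> \<le> real k" by simp
    moreover have "?r (k * m) - ?r m = (real_of_int (f (k * m)) - real k * real_of_int (f m)) / (real k * real m)"
      using that by (simp add: field_simps)
    ultimately show ?thesis using that by (simp add: abs_mult divide_simps mult.commute)
  qed
  \<comment> \<open>Both ratios are compared with the one at the common multiple
    \<open>m * n\<close>.\<close>
  have near': "\<bar>?r n - ?r m\<bar> \<le> 1 / real n + 1 / real m" if "n > 0" "m > 0" for n m
    using near[of m n] near[of n m] that by (simp add: mult.commute)
  have "Cauchy ?r"
  proof (rule metric_CauchyI)
    fix e :: real assume "e > 0"
    then obtain N :: nat where N: "N > 0" "1 / real N < e / 2"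
      using nat_approx_posE[of "e / 2"] by (metis half_gt_zero zero_less_Suc of_nat_Suc)
    show "\<exists>M. \<forall>m\<ge>M. \<forall>n\<ge>M. dist (?r m) (?r n) < e"
    proof (intro exI allI impI)
      fix m n assume "N \<le> m" "N \<le> n"
      then have "1 / real m \<le> 1 / real N" "1 / real n \<le> 1 / real N" "m > 0" "n > 0"
        using N(1) by (auto simp: frac_le)
      then show "dist (?r m) (?r n) < e" using near'[of m n] N(2) by (simp add: dist_real_def)
    qed
  qed
  then show conv: "convergent ?r" by (rule Cauchy_convergent)
  \<comment> \<open>Letting \<open>n\<close> tend to infinity in \<open>near'\<close> removes the
    term \<open>1 / n\<close> and leaves the stated bound.\<close>
  have "(\<lambda>n. 1 / real n + 1 / real m - \<bar>?r n - ?r m\<bar>) \<longlonglongrightarrow> 0 + 1 / real m - \<bar>lim ?r - ?r m\<bar>"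
    using conv unfolding convergent_LIMSEQ_iff by (intro tendsto_intros lim_1_over_n) auto
  moreover have "eventually (\<lambda>n. 0 \<le> 1 / real n + 1 / real m - \<bar>?r n - ?r m\<bar>) sequentially"
    using eventually_gt_at_top[of 0] by eventually_elim (use near' m in auto)
  ultimately show "\<bar>lim ?r - ?r m\<bar> \<le> 1 / real m"
    using tendsto_lowerbound[of _ _ sequentially 0] by fastforce
qed

section \<open>Dependence on the ordering\<close>

text \<open>In both cases of \<open>rho\<close>, the value is the exponent \<open>N\<close> with \<open>x\<^sup>N \<le> h < x\<^sup>N\<^sup>+\<^sup>1\<close> for this order.\<close>

definition oriented_less :: "('a, 'm) monoid_scheme \<Rightarrow> 'a \<Rightarrow> 'a set \<Rightarrow> 'a \<Rightarrow> 'a \<Rightarrow> bool" where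
  "oriented_less G x P a b \<longleftrightarrow>
    (if cone_less G P \<one>\<^bsub>G\<^esub> x then cone_less G P a b else cone_less G P b a)"

locale cofinal_element = group G for G (structure) +
  fixes x :: 'a and H :: "'a set"
  assumes x_closed [simp]: "x \<in> carrier G" and subgroup_H: "subgroup H G"
begin

abbreviation "Inv \<equiv> InvLO G H x"
abbreviation "InvCof \<equiv> InvLO G H x \<inter> Cof G H x"
abbreviation "GH \<equiv> G\<lparr>carrier := H\<rparr>"

lemma H_closed [simp]: "h \<in> H \<Longrightarrow> h \<in> carrier G"
  using subgroup_H by (auto dest: subgroup.mem_carrier)

lemma group_GH: "group GH"
  using subgroup.subgroup_is_group[OF subgroup_H group_axioms] .

lemma pow_H [simp]: "h \<in> H \<Longrightarrow> h [^] (n::nat) \<in> H"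
  using subgroup_H by (induction n) (auto intro: subgroup.m_closed subgroup.one_closed)

lemma mult_H [simp]: "g \<in> H \<Longrightarrow> h \<in> H \<Longrightarrow> g \<otimes> h \<in> H"
  using subgroup_H by (auto intro: subgroup.m_closed)

lemma LO_strict_order:
  assumes "P \<in> LO G"
  shows "a \<in> carrier G \<Longrightarrow> \<not> cone_less G P a a"
    and "a \<in> carrier G \<Longrightarrow> b \<in> carrier G \<Longrightarrow> c \<in> carrier G \<Longrightarrow>
      cone_less G P a b \<Longrightarrow> cone_less G P b c \<Longrightarrow> cone_less G P a c"
    and "a \<in> carrier G \<Longrightarrow> b \<in> carrier G \<Longrightarrow> a \<noteq> b \<Longrightarrow> cone_less G P a b \<or> cone_less G P b a"
    and "a \<in> carrier G \<Longrightarrow> b \<in> carrier G \<Longrightarrow> c \<in> carrier G \<Longrightarrow>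
      cone_less G P a b \<Longrightarrow> cone_less G P (c \<otimes> a) (c \<otimes> b)"
proof -
  obtain r where r: "r \<in> left_orderings G" and P: "P = positive_cone G r"
    using assms by (auto simp: LO_def)
  note iff = cone_less_positive_cone[OF group_axioms r, folded P]
  have "trans r" "irrefl r" "total_on (carrier G) r"
    and left: "\<And>a b c. a \<in> carrier G \<Longrightarrow> b \<in> carrier G \<Longrightarrow> c \<in> carrier G \<Longrightarrow>
      (a, b) \<in> r \<Longrightarrow> (c \<otimes> a, c \<otimes> b) \<in> r"
    using r by (auto simp: left_orderings_def strict_linear_order_on_def)
  then show "a \<in> carrier G \<Longrightarrow> \<not> cone_less G P a a"
    and "a \<in> carrier G \<Longrightarrow> b \<in> carrier G \<Longrightarrow> c \<in> carrier G \<Longrightarrow>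
      cone_less G P a b \<Longrightarrow> cone_less G P b c \<Longrightarrow> cone_less G P a c"
    and "a \<in> carrier G \<Longrightarrow> b \<in> carrier G \<Longrightarrow> a \<noteq> b \<Longrightarrow> cone_less G P a b \<or> cone_less G P b a"
    and "a \<in> carrier G \<Longrightarrow> b \<in> carrier G \<Longrightarrow> c \<in> carrier G \<Longrightarrow>
      cone_less G P a b \<Longrightarrow> cone_less G P (c \<otimes> a) (c \<otimes> b)"
    by (simp_all add: iff irrefl_def) (auto dest: transD simp: total_on_def)
qed

text \<open>Reversal preserves every axiom except positivity of \<open>x\<close>. Since
  \<open>x\<close> is not the identity, exactly one of the two orientations makes it
  positive.\<close>

lemma invariant_order_oriented_less:
  assumes P: "P \<in> Inv" and x: "x \<noteq> \<one>"
  shows "invariant_order G x H (oriented_less G x P)"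
proof -
  have LO: "P \<in> LO G" using P by (simp add: InvLO_def)
  note order = LO_strict_order[OF LO]
  have right: "cone_less G P (c \<otimes> x) (c' \<otimes> x)"
    if "c \<in> generate G (insert x H)" "c' \<in> generate G (insert x H)" "cone_less G P c c'" for c c'
    using P that by (simp add: InvLO_def)
  show ?thesis
  proof (intro invariant_order.intro invariant_order_axioms.intro group_axioms)
    show "oriented_less G x P \<one> x" using order(3)[of \<one> x] x by (auto simp: oriented_less_def)
  next
    fix a b c assume "a \<in> carrier G" "b \<in> carrier G" "c \<in> carrier G"
      "oriented_less G x P a b" "oriented_less G x P b c"
    then show "oriented_less G x P a c"
      using order(2)[of a b c] order(2)[of c b a] by (simp add: oriented_less_def split: if_splits)
  next
    fix a b assume "a \<in> carrier G" "b \<in> carrier G" "a \<noteq> b"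
    then show "oriented_less G x P a b \<or> oriented_less G x P b a"
      using order(3)[of a b] by (auto simp: oriented_less_def)
  qed (use order(1,4) right subgroup_H in \<open>simp_all add: oriented_less_def split: if_splits\<close>)
qed

lemma Cof_imp_ne_one:
  assumes "P \<in> Cof G H x" shows "x \<noteq> \<one>"
proof
  assume "x = \<one>"
  moreover have "\<one> \<in> H" using subgroup_H by (rule subgroup.one_closed)
  ultimately have "cone_less G P \<one> \<one>" and "P \<in> LO G" using assms by (auto simp: Cof_def)
  then show False using LO_strict_order(1) by blast
qed

lemma Cof_iff_cofinal:
  assumes "P \<in> Inv" and "x \<noteq> \<one>"
  shows "P \<in> Cof G H x \<longleftrightarrow> (\<forall>a\<in>H. invariant_order.cofinal G x (oriented_less G x P) a)"
proof -
  interpret invariant_order G x H "oriented_less G x P"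
    using assms by (rule invariant_order_oriented_less)
  have "cofinal a \<longleftrightarrow> (\<exists>N::int. cone_less G P (x [^] (- N)) a \<and> cone_less G P a (x [^] N))" for a
  proof (cases "cone_less G P \<one> x")
    case False
    then have "cofinal a \<longleftrightarrow> (\<exists>N::int. cone_less G P (x [^] N) a \<and> cone_less G P a (x [^] (- N)))"
      by (auto simp: cofinal_def oriented_less_def)
    \<comment> \<open>Replacing \<open>N\<close> by \<open>- N\<close> undoes the exchange of the
      two bounds caused by the reversal.\<close>
    also have "\<dots> \<longleftrightarrow> (\<exists>N::int. cone_less G P (x [^] (- N)) a \<and> cone_less G P a (x [^] N))"
      by (metis minus_minus)
    finally show ?thesis .
  qed (simp add: cofinal_def oriented_less_def)
  moreover have "P \<in> LO G" using assms by (simp add: InvLO_def)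
  ultimately show ?thesis by (simp add: Cof_def)
qed

text \<open>Both branches of \<open>rho\<close> become the same description for the oriented order;
  cofinality supplies existence and \<open>bracket_unique\<close> uniqueness.\<close>

lemma bracket_rho:
  assumes P: "P \<in> InvCof" and h: "h \<in> H"
  shows "invariant_order.bracket G x (oriented_less G x P) h (rho G x P h)"
proof -
  have x: "x \<noteq> \<one>" using P Cof_imp_ne_one by blast
  interpret invariant_order G x H "oriented_less G x P"
    using P x by (intro invariant_order_oriented_less) auto
  have "cofinal h" using P h x Cof_iff_cofinal[of P] by auto
  then obtain N where N: "bracket h N" using h by (auto simp: cofinal_iff_bracket)
  have "rho G x P h = (THE N. bracket h N)"
    by (auto simp: rho_def bracket_def oriented_less_def cone_le_def intro!: arg_cong[of _ _ The])
  also have "\<dots> = N" using N bracket_unique[of h] h by (intro the_equality) auto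
  finally show ?thesis using N by simp
qed

lemma rho_defect:
  assumes P: "P \<in> InvCof" and g: "g \<in> H" and h: "h \<in> H"
  shows "rho G x P g + rho G x P h \<le> rho G x P (g \<otimes> h)"
    and "rho G x P (g \<otimes> h) \<le> rho G x P g + rho G x P h + 1"
proof -
  have x: "x \<noteq> \<one>" using P Cof_imp_ne_one by blast
  interpret invariant_order G x H "oriented_less G x P"
    using P x by (intro invariant_order_oriented_less) auto
  note b = bracket_mult_defect[OF g bracket_rho[OF P g] h bracket_rho[OF P h] bracket_rho[OF P mult_H[OF g h]]]
  show "rho G x P g + rho G x P h \<le> rho G x P (g \<otimes> h)" by (rule b)
  show "rho G x P (g \<otimes> h) \<le> rho G x P g + rho G x P h + 1" by (rule b)
qed

text \<open>The error bound does not depend on \<open>P\<close>, which is what continuity in the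
  ordering rests on.\<close>

lemma rho_bar_approx:
  assumes P: "P \<in> InvCof" and h: "h \<in> H"
  shows "n > 0 \<Longrightarrow> \<bar>rho_bar G x P h - real_of_int (rho G x P (h [^] n)) / real n\<bar> \<le> 1 / real n"
    and "(\<lambda>n. real_of_int (rho G x P (h [^] n)) / real n) \<longlonglongrightarrow> rho_bar G x P h"
proof -
  have f: "rho G x P (h [^] m) + rho G x P (h [^] n) \<le> rho G x P (h [^] (m + n))"
    "rho G x P (h [^] (m + n)) \<le> rho G x P (h [^] m) + rho G x P (h [^] n) + 1" for m n :: nat
    using rho_defect[OF P, of "h [^] m" "h [^] n"] h by (simp_all add: nat_pow_mult)
  show "\<bar>rho_bar G x P h - real_of_int (rho G x P (h [^] n)) / real n\<bar> \<le> 1 / real n" if "n > 0"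
    using superadditive_ratio(1)[of "\<lambda>n. rho G x P (h [^] n)", OF f that] by (simp add: rho_bar_def)
  show "(\<lambda>n. real_of_int (rho G x P (h [^] n)) / real n) \<longlonglongrightarrow> rho_bar G x P h"
    using superadditive_ratio(2)[of "\<lambda>n. rho G x P (h [^] n)" 1, OF f]
    by (simp add: rho_bar_def convergent_LIMSEQ_iff)
qed

lemma rho_bar_near_rho:
  assumes "P \<in> InvCof" and "h \<in> H"
  shows "\<bar>rho_bar G x P h - real_of_int (rho G x P h)\<bar> \<le> 1"
  using rho_bar_approx(1)[OF assms, of 1] assms(2) by simp

text \<open>Vanishing of the real kernel puts \<open>rho\<close> within bounded distance of a
  homomorphism \<open>\<tau>\<close>. Dividing along powers of an element removes the error, so
  \<open>rho_bar\<close> equals \<open>\<tau>\<close> on \<open>H\<close>.\<close>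

lemma rho_bar_additive:
  assumes trivial: "carrier (Hb2 GH :: ('a \<times> 'a \<Rightarrow> real) set monoid) = {\<one>\<^bsub>Hb2 GH\<^esub>}"
    and P: "P \<in> InvCof" and g: "g \<in> H" and h: "h \<in> H"
  shows "rho_bar G x P (g \<otimes> h) = rho_bar G x P g + rho_bar G x P h"
proof -
  have "\<bar>real_of_int (rho G x P g) - real_of_int (rho G x P (g \<otimes>\<^bsub>GH\<^esub> h)) + real_of_int (rho G x P h)\<bar> \<le> 1"
    if "g \<in> carrier GH" "h \<in> carrier GH" for g h
    using rho_defect[OF P, of g h] that by simp
  from quasimorphism_decomposition[OF group_GH trivial this] obtain \<tau> B
    where add: "\<And>g h. g \<in> carrier GH \<Longrightarrow> h \<in> carrier GH \<Longrightarrow> \<tau> (g \<otimes>\<^bsub>GH\<^esub> h) = \<tau> g + \<tau> h"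
      and B: "\<And>g. g \<in> carrier GH \<Longrightarrow> \<bar>real_of_int (rho G x P g) - \<tau> g\<bar> \<le> B" by metis
  have eq: "rho_bar G x P h = \<tau> h" if h: "h \<in> H" for h
  proof (rule LIMSEQ_unique[OF rho_bar_approx(2)[OF P h]])
    have \<tau>: "\<tau> (h [^] n) = real n * \<tau> h" for n :: nat
      using additive_nat_pow[OF group_GH, of \<tau> h n] add h by (simp add: nat_pow_consistent[symmetric])
    show "(\<lambda>n. real_of_int (rho G x P (h [^] n)) / real n) \<longlonglongrightarrow> \<tau> h"
    \<comment> \<open>For positive \<open>n\<close>, the ratio is \<open>\<tau> h\<close> plus a
      bounded error divided by \<open>n\<close>.\<close>
    proof (rule Lim_transform_eventually)
      have "(\<lambda>n. (real_of_int (rho G x P (h [^] n)) - \<tau> (h [^] n)) / real n) \<longlonglongrightarrow> 0"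
      proof (rule Lim_null_comparison)
        show "\<forall>\<^sub>F n in sequentially. norm ((real_of_int (rho G x P (h [^] n)) - \<tau> (h [^] n)) / real n) \<le> B / real n"
          using B h by (intro always_eventually allI) (simp add: divide_right_mono)
        show "(\<lambda>n. B / real n) \<longlonglongrightarrow> 0" by (rule lim_const_over_n)
      qed
      then show "(\<lambda>n. (real_of_int (rho G x P (h [^] n)) - \<tau> (h [^] n)) / real n + \<tau> h) \<longlonglongrightarrow> \<tau> h"
        using tendsto_add[OF _ tendsto_const, of _ 0 sequentially "\<tau> h"] by simp
      show "\<forall>\<^sub>F n in sequentially. (real_of_int (rho G x P (h [^] n)) - \<tau> (h [^] n)) / real n + \<tau> h
          = real_of_int (rho G x P (h [^] n)) / real n"
        using eventually_gt_at_top[of 0] by eventually_elim (simp add: \<tau> diff_divide_distrib)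
    qed
  qed
  show ?thesis using add[of g h] g h by (simp add: eq)
qed

text \<open>The bound 2 adds the distance from \<open>rho\<close> to \<open>rho_bar\<close> and the
  loss from taking the floor. The class is thereby in the form that the chart can evaluate.\<close>

lemma psi_eq_floor:
  assumes P: "P \<in> InvCof"
  shows "psi G H x P = qm_class GH (\<lambda>h. \<lfloor>rho_bar G x P h\<rfloor>)"
  unfolding psi_def
proof (rule qm_class_eqI[OF group_GH, of "\<lambda>_. 0" _ _ 2])
  fix h assume "h \<in> carrier GH"
  then have "\<bar>rho_bar G x P h - real_of_int (rho G x P h)\<bar> \<le> 1" using rho_bar_near_rho[OF P] by simp
  then show "\<bar>rho G x P h - \<lfloor>rho_bar G x P h\<rfloor> - 0\<bar> \<le> 2" by linarith
qed simp

lemma psi_mem_Hb2: "P \<in> InvCof \<Longrightarrow> psi G H x P \<in> carrier (Hb2 GH)"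
  unfolding psi_def using rho_defect[of P]
  by (intro qm_class_mem_Hb2[OF group_GH, of _ 1]) (fastforce simp: abs_le_iff)

section \<open>Open conditions on orderings\<close>

lemma openin_cone_less:
  assumes "a \<in> carrier G" "c \<in> carrier G"
  shows "openin (LO_topology G) {P \<in> LO G. cone_less G P a c}"
proof -
  have "{P \<in> LO G. cone_less G P a c} = {P \<in> LO G. cone_less G P \<one> (inv a \<otimes> c)}"
    using assms by (simp add: cone_less_def)
  then show ?thesis using assms unfolding LO_topology_def
    by (intro topology_generated_by_Basis) auto
qed

lemma openin_oriented_less:
  assumes "x \<noteq> \<one>" "a \<in> carrier G" "c \<in> carrier G"
  shows "openin (LO_topology G) {P \<in> LO G. oriented_less G x P a c}"
proof -
  \<comment> \<open>A negated comparison is not visibly open; totality turns it into a strict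
    comparison.\<close>
  have neg: "\<not> cone_less G P \<one> x \<longleftrightarrow> cone_less G P x \<one>" if "P \<in> LO G" for P
    using LO_strict_order(1-3)[OF that] assms(1) x_closed one_closed by metis
  have "{P \<in> LO G. oriented_less G x P a c} =
      ({P \<in> LO G. cone_less G P \<one> x} \<inter> {P \<in> LO G. cone_less G P a c}) \<union>
      ({P \<in> LO G. cone_less G P x \<one>} \<inter> {P \<in> LO G. cone_less G P c a})"
    using neg by (auto simp: oriented_less_def)
  then show ?thesis using assms by (auto intro!: openin_Un openin_Int openin_cone_less)
qed

text \<open>On \<open>InvCof\<close> the equation is the condition \<open>bracket h N\<close>, which
  involves only two comparisons with powers of \<open>x\<close>.\<close>

lemma openin_rho_eq:
  assumes h: "h \<in> H"
  shows "openin (subtopology (LO_topology G) InvCof) {P \<in> InvCof. rho G x P h = N}"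
proof (cases "x = \<one>")
  case True
  then have "InvCof = {}" using Cof_imp_ne_one by blast
  then show ?thesis by simp
next
  case False
  let ?U = "{P \<in> LO G. oriented_less G x P (x [^] N) h \<or> x [^] N = h} \<inter>
    {P \<in> LO G. oriented_less G x P h (x [^] (N + 1))}"
  have "openin (LO_topology G) {P \<in> LO G. oriented_less G x P (x [^] N) h \<or> x [^] N = h}"
  \<comment> \<open>The weak inequality is no obstacle: equality does not depend on
    \<open>P\<close>, so the set is the whole space or given by a strict comparison.\<close>
  proof (cases "x [^] N = h")
    case True
    then show ?thesis using openin_topspace[of "LO_topology G"] by (simp add: topspace_LO_topology)
  qed (use False h openin_oriented_less in simp)
  then have "openin (LO_topology G) ?U" using False h by (intro openin_Int openin_oriented_less) simp_all
  moreover have "{P \<in> InvCof. rho G x P h = N} = InvCof \<inter> ?U"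
  proof -
    have "rho G x P h = N \<longleftrightarrow> P \<in> ?U" if P: "P \<in> InvCof" for P
    proof -
      interpret invariant_order G x H "oriented_less G x P"
        using P False by (intro invariant_order_oriented_less) auto
      have "P \<in> LO G" using P by (simp add: InvLO_def)
      then have "P \<in> ?U \<longleftrightarrow> bracket h N" by (simp add: bracket_def)
      also have "\<dots> \<longleftrightarrow> rho G x P h = N"
        using bracket_rho[OF P h] bracket_unique[of h] h by auto
      finally show ?thesis by simp
    qed
    then show ?thesis by auto
  qed
  ultimately show ?thesis by (simp add: openin_subtopology_Int2)
qed

text \<open>The value of \<open>rho\<close> at a high power of \<open>h\<close> is locally constant,
  and where it is constant \<open>rho_bar\<close> varies by at most twice the uniform error.\<close>

lemma continuous_rho_bar:
  assumes h: "h \<in> H"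
  shows "continuous_map (subtopology (LO_topology G) InvCof) euclideanreal (\<lambda>P. rho_bar G x P h)"
proof -
  let ?T = "subtopology (LO_topology G) InvCof"
  have top: "topspace ?T = InvCof"
    by (auto simp: topspace_LO_topology InvLO_def)
  have "\<exists>U. openin ?T U \<and> P \<in> U \<and> (\<forall>Q\<in>U. rho_bar G x Q h \<in> ball (rho_bar G x P h) e)"
    if P: "P \<in> InvCof" and "e > 0" for P e
  proof -
    obtain n where n: "1 / real (Suc n) < e / 2"
      using nat_approx_posE[of "e / 2"] \<open>e > 0\<close> by auto
    let ?N = "rho G x P (h [^] Suc n)"
    let ?U = "{Q \<in> InvCof. rho G x Q (h [^] Suc n) = ?N}"
    have "openin ?T ?U" using h by (intro openin_rho_eq pow_H)
    moreover have "rho_bar G x Q h \<in> ball (rho_bar G x P h) e" if "Q \<in> ?U" for Q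
      using rho_bar_approx(1)[OF P h, of "Suc n"] rho_bar_approx(1)[OF _ h, of Q "Suc n"] that n
      by (simp add: dist_real_def del: nat_pow_Suc of_nat_Suc)
    ultimately show ?thesis using P by blast
  qed
  then show ?thesis
    using Met_TC.continuous_map_to_metric[of ?T "\<lambda>P. rho_bar G x P h"] top by simp
qed

lemma openin_InvCof:
  assumes S: "finite S" "generate G S = H"
  shows "openin (subtopology (LO_topology G) Inv) InvCof"
proof (cases "x = \<one>")
  case True
  then have "InvCof = {}" using Cof_imp_ne_one by blast
  then show ?thesis by simp
next
  case False
  have SH: "S \<subseteq> H" using S(2) by (auto intro: generate.incl)
  let ?C = "\<lambda>s. \<Union>N::int. {P \<in> LO G. oriented_less G x P (x [^] (- N)) s} \<inter>
    {P \<in> LO G. oriented_less G x P s (x [^] N)}"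
  \<comment> \<open>Intersecting with the whole space also covers an empty \<open>S\<close>, where
    the indexed intersection is \<open>UNIV\<close>.\<close>
  have "openin (LO_topology G) ((\<Inter>s\<in>S. ?C s) \<inter> topspace (LO_topology G))"
    using S(1) False SH by (intro openin_INT openin_Union) (auto intro!: openin_Int openin_oriented_less)
  then have "openin (subtopology (LO_topology G) Inv) (Inv \<inter> ((\<Inter>s\<in>S. ?C s) \<inter> topspace (LO_topology G)))"
    by (rule openin_subtopology_Int2)
  moreover have "InvCof = Inv \<inter> ((\<Inter>s\<in>S. ?C s) \<inter> topspace (LO_topology G))"
  proof -
    have "P \<in> Cof G H x \<longleftrightarrow> (\<forall>s\<in>S. P \<in> ?C s)" if P: "P \<in> Inv" for P
    proof -
      interpret invariant_order G x H "oriented_less G x P"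
        using P False by (rule invariant_order_oriented_less)
      have "P \<in> LO G" using P by (simp add: InvLO_def)
      then have "P \<in> ?C s \<longleftrightarrow> cofinal s" for s by (simp add: cofinal_def)
      moreover have "(\<forall>s\<in>S. cofinal s) \<longleftrightarrow> (\<forall>h\<in>H. cofinal h)"
        using cofinal_generate[OF S(2)] SH by blast
      ultimately show ?thesis using Cof_iff_cofinal[OF P False] by simp
    qed
    then show ?thesis by (auto simp: topspace_LO_topology InvLO_def)
  qed
  ultimately show ?thesis by (simp only:)
qed

end

text \<open>Each coordinate projection has compact image. Only the first \<open>b\<close>
  coordinates can be nonzero, so the sum of their bounds is a common bound.\<close>

lemma compactin_Euclidean_space_bounded:
  assumes "compactin (Euclidean_space b) C"
  obtains R where "R \<ge> 0" "\<And>v i. v \<in> C \<Longrightarrow> \<bar>v i\<bar> \<le> R"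
proof -
  have "\<exists>R. \<forall>v\<in>C. \<bar>v i\<bar> \<le> R" for i
  proof -
    have "continuous_map (Euclidean_space b) euclideanreal (\<lambda>v. v i)"
      unfolding Euclidean_space_def
      by (intro continuous_map_from_subtopology continuous_map_product_projection) simp
    then have "compact ((\<lambda>v. v i) ` C)"
      using image_compactin[OF assms] by fastforce
    then have "bounded ((\<lambda>v. v i) ` C)" by (rule compact_imp_bounded)
    then show ?thesis by (auto simp: bounded_iff)
  qed
  then obtain B where B: "\<And>i v. v \<in> C \<Longrightarrow> \<bar>v i\<bar> \<le> B i" by metis
  have zero: "v i = 0" if "v \<in> C" "i \<ge> b" for v i
    using that compactin_subset_topspace[OF assms] by (auto simp: topspace_Euclidean_space)
  show thesis
  proof
    show nonneg: "(\<Sum>i<b. \<bar>B i\<bar>) \<ge> 0" by (simp add: sum_nonneg)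
    fix v i assume v: "v \<in> C"
    show "\<bar>v i\<bar> \<le> (\<Sum>i<b. \<bar>B i\<bar>)"
    proof (cases "i < b")
      case True
      have "\<bar>v i\<bar> \<le> \<bar>B i\<bar>" using B[OF v, of i] by linarith
      also have "\<dots> \<le> (\<Sum>i<b. \<bar>B i\<bar>)" using True by (intro member_le_sum) auto
      finally show ?thesis .
    next
      case False
      then show ?thesis using zero[OF v, of i] nonneg by simp
    qed
  qed
qed

section \<open>Continuity of the two maps\<close>

context cofinal_element
begin

lemma topspace_Inv: "topspace (subtopology (LO_topology G) Inv) = Inv"
  and topspace_InvCof: "topspace (subtopology (LO_topology G) InvCof) = InvCof"
  by (auto simp: topspace_LO_topology InvLO_def)

text \<open>For a pullback topology it suffices that the chart composed with \<open>psi\<close> is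
  continuous; this composite has the entries
  \<open>cis (2 * pi * rho_bar G x P (y i))\<close>.\<close>

lemma continuous_psi:
  assumes trivial: "carrier (Hb2 GH :: ('a \<times> 'a \<Rightarrow> real) set monoid) = {\<one>\<^bsub>Hb2 GH\<^esub>}"
    and y: "\<And>i. i < b \<Longrightarrow> y i \<in> H"
  shows "continuous_map (subtopology (LO_topology G) InvCof) (Hb2_topology GH b y) (psi G H x)"
  unfolding Hb2_topology_def
proof (rule continuous_map_pullback')
  let ?T = "subtopology (LO_topology G) InvCof"
  let ?c = "torus_coords b y \<circ> inv_into (carrier (cohomology1_real_mod_int GH)) (floor_iso GH)"
  have eq: "?c (psi G H x P) = (\<lambda>i\<in>{..<b}. cis (2 * pi * rho_bar G x P (y i)))" if P: "P \<in> InvCof" for P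
    unfolding psi_eq_floor[OF P]
    by (rule Hb2_coordinates_floor[OF group_GH]) (use y rho_bar_additive[OF trivial P] in simp_all)
  have "continuous_map ?T (torus b) (\<lambda>P. \<lambda>i\<in>{..<b}. cis (2 * pi * rho_bar G x P (y i)))"
    unfolding torus_def
  proof (subst continuous_map_componentwise, intro conjI ballI)
    fix i assume i: "i \<in> {..<b}"
    have "continuous_map ?T euclidean ((\<lambda>t. cis (2 * pi * t)) \<circ> (\<lambda>P. rho_bar G x P (y i)))"
      using i y by (intro continuous_map_compose[OF continuous_rho_bar])
        (auto intro!: continuous_intros simp: continuous_map_iff_continuous2)
    then show "continuous_map ?T (top_of_set (sphere 0 1))
        (\<lambda>P. (\<lambda>i\<in>{..<b}. cis (2 * pi * rho_bar G x P (y i))) i)"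
      using i by (auto simp: continuous_map_in_subtopology o_def)
  qed auto
  then show "continuous_map ?T (torus b) (?c \<circ> psi G H x)"
  proof (rule continuous_map_eq)
    fix P assume "P \<in> topspace ?T"
    then show "(\<lambda>i\<in>{..<b}. cis (2 * pi * rho_bar G x P (y i))) = (?c \<circ> psi G H x) P"
      unfolding topspace_InvCof using eq by simp
  qed
  show "topspace ?T \<subseteq> psi G H x -` carrier (Hb2 GH)"
    unfolding topspace_InvCof using psi_mem_Hb2 by blast
qed

text \<open>Some \<open>c\<close> exceeds all powers of \<open>x\<close> at \<open>P\<close>.
  Exceeding one given power is an open condition, and it bounds \<open>rho\<close> at
  \<open>c\<close> from below at nearby cofinal orderings.\<close>

lemma rho_bar_unbounded_near_infinity:
  assumes P: "P \<in> Inv" "P \<notin> Cof G H x" and x: "x \<noteq> \<one>"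
  obtains c where "c \<in> H"
    and "\<And>C. \<exists>U. openin (subtopology (LO_topology G) Inv) U \<and> P \<in> U \<and>
      (\<forall>Q\<in>U \<inter> Cof G H x. C < rho_bar G x Q c)"
proof -
  interpret invariant_order G x H "oriented_less G x P"
    using P(1) x by (rule invariant_order_oriented_less)
  obtain a where "a \<in> H" "\<not> cofinal a" using Cof_iff_cofinal[OF P(1) x] P(2) by blast
  then obtain c where c: "c \<in> H" "\<And>n::int. oriented_less G x P (x [^] n) c"
    using not_cofinal_unbounded by metis
  show thesis
  proof (rule that[OF c(1)])
    fix C :: real
    \<comment> \<open>One unit absorbs the distance between \<open>rho\<close> and
      \<open>rho_bar\<close>, the other makes the final inequality strict.\<close>
    let ?n = "\<lfloor>C\<rfloor> + 2"
    let ?U = "Inv \<inter> {Q \<in> LO G. oriented_less G x Q (x [^] ?n) c}"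
    have "C < rho_bar G x Q c" if Q: "Q \<in> ?U \<inter> Cof G H x" for Q
    proof -
      interpret Q: invariant_order G x H "oriented_less G x Q"
        using Q x by (intro invariant_order_oriented_less) auto
      have "?n \<le> rho G x Q c"
        using Q c(1) by (intro Q.bracket_le[of c] bracket_rho) auto
      moreover have "\<bar>rho_bar G x Q c - real_of_int (rho G x Q c)\<bar> \<le> 1"
        using Q c(1) by (intro rho_bar_near_rho) auto
      ultimately show ?thesis by linarith
    qed
    moreover have "openin (subtopology (LO_topology G) Inv) ?U"
      using x c(1) by (intro openin_subtopology_Int2 openin_oriented_less) auto
    moreover have "P \<in> ?U" using P c(2) by (simp add: InvLO_def)
    ultimately show "\<exists>U. openin (subtopology (LO_topology G) Inv) U \<and> P \<in> U \<and>
      (\<forall>Q\<in>U \<inter> Cof G H x. C < rho_bar G x Q c)" by blast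
  qed
qed

text \<open>On a compact set the coordinates are bounded by some \<open>R\<close>, which bounds the
  integer combination giving \<open>rho_bar\<close> at \<open>c\<close>. Near \<open>P\<close> that
  value is larger.\<close>

lemma psi_tilde_escapes:
  assumes trivial: "carrier (Hb2 GH :: ('a \<times> 'a \<Rightarrow> real) set monoid) = {\<one>\<^bsub>Hb2 GH\<^esub>}"
    and basis: "homology1_basis GH b y"
    and P: "P \<in> Inv" "P \<notin> Cof G H x" and C: "compactin (Euclidean_space b) C"
  shows "\<exists>U. openin (subtopology (LO_topology G) Inv) U \<and> P \<in> U \<and>
    (\<forall>Q\<in>U. psi_tilde G H x b y Q \<notin> Some ` C)"
proof (cases "x = \<one>")
  case True
  \<comment> \<open>For \<open>x = \<one>\<close> no ordering is cofinal, so the map is constantly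
    the point at infinity.\<close>
  then have "psi_tilde G H x b y Q = None" for Q
    using Cof_imp_ne_one by (auto simp: psi_tilde_def)
  then show ?thesis
    using P openin_topspace[of "subtopology (LO_topology G) Inv"] unfolding topspace_Inv by auto
next
  case False
  obtain R where R: "R \<ge> 0" "\<And>v i. v \<in> C \<Longrightarrow> \<bar>v i\<bar> \<le> R"
    using compactin_Euclidean_space_bounded[OF C] by metis
  obtain c where c: "c \<in> H" and near: "\<And>B. \<exists>U. openin (subtopology (LO_topology G) Inv) U \<and> P \<in> U \<and>
      (\<forall>Q\<in>U \<inter> Cof G H x. B < rho_bar G x Q c)"
    using rho_bar_unbounded_near_infinity[OF P False] by metis
  obtain n :: "nat \<Rightarrow> int" where n: "\<And>\<tau> :: 'a \<Rightarrow> real. (\<And>g h. g \<in> carrier GH \<Longrightarrow> h \<in> carrier GH \<Longrightarrow>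
      \<tau> (g \<otimes>\<^bsub>GH\<^esub> h) = \<tau> g + \<tau> h) \<Longrightarrow> \<tau> c = (\<Sum>i<b. of_int (n i) * \<tau> (y i))"
    using homology1_basis_additive[OF group_GH basis, of c] c by auto
  obtain U where U: "openin (subtopology (LO_topology G) Inv) U" "P \<in> U"
    and far: "\<And>Q. Q \<in> U \<Longrightarrow> Q \<in> Cof G H x \<Longrightarrow> (\<Sum>i<b. \<bar>real_of_int (n i)\<bar> * R) < rho_bar G x Q c"
    using near[of "\<Sum>i<b. \<bar>real_of_int (n i)\<bar> * R"] by blast
  have "psi_tilde G H x b y Q \<notin> Some ` C" if Q: "Q \<in> U" for Q
  proof
    assume mem: "psi_tilde G H x b y Q \<in> Some ` C"
    then have cof: "Q \<in> Cof G H x" and v: "(\<lambda>i. if i < b then rho_bar G x Q (y i) else 0) \<in> C"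
      by (auto simp: psi_tilde_def split: if_splits)
    have "Q \<in> InvCof" using cof openin_subset[OF U(1)] Q unfolding topspace_Inv by blast
    then have "rho_bar G x Q c = (\<Sum>i<b. of_int (n i) * rho_bar G x Q (y i))"
      using rho_bar_additive[OF trivial] by (intro n) simp
    also have "\<dots> \<le> (\<Sum>i<b. \<bar>real_of_int (n i)\<bar> * R)"
    proof (rule sum_mono)
      fix i assume "i \<in> {..<b}"
      then have "\<bar>rho_bar G x Q (y i)\<bar> \<le> R" using R(2)[OF v, of i] by simp
      then have "\<bar>of_int (n i) * rho_bar G x Q (y i)\<bar> \<le> \<bar>real_of_int (n i)\<bar> * R"
        by (simp add: abs_mult mult_left_mono)
      then show "of_int (n i) * rho_bar G x Q (y i) \<le> \<bar>real_of_int (n i)\<bar> * R" by linarith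
    qed
    finally show False using far[OF Q cof] by simp
  qed
  then show ?thesis using U by blast
qed

text \<open>Open sets avoiding infinity pull back into the open set \<open>InvCof\<close>. For
  neighbourhoods of infinity, cofinal points are handled inside \<open>InvCof\<close> and the others
  by \<open>psi_tilde_escapes\<close>.\<close>

lemma continuous_psi_tilde:
  assumes S: "finite S" "generate G S = H"
    and trivial: "carrier (Hb2 GH :: ('a \<times> 'a \<Rightarrow> real) set monoid) = {\<one>\<^bsub>Hb2 GH\<^esub>}"
    and basis: "homology1_basis GH b y"
  shows "continuous_map (subtopology (LO_topology G) Inv)
    (Alexandroff_compactification (Euclidean_space b)) (psi_tilde G H x b y)"
proof -
  let ?T = "subtopology (LO_topology G) Inv"
  let ?v = "\<lambda>P i. if i < b then rho_bar G x P (y i) else 0"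
  have y: "y i \<in> H" if "i < b" for i using basis that by (simp add: homology1_basis_def)
  have v: "continuous_map (subtopology (LO_topology G) InvCof) (Euclidean_space b) ?v"
    unfolding continuous_map_componentwise_Euclidean_space using y continuous_rho_bar by blast
  have finite_part: "openin ?T {P \<in> InvCof. ?v P \<in> V}" if "openin (Euclidean_space b) V" for V
  proof -
    have "openin (subtopology (LO_topology G) InvCof) {P \<in> InvCof. ?v P \<in> V}"
      using openin_continuous_map_preimage[OF v that] unfolding topspace_InvCof .
    moreover have "subtopology (LO_topology G) InvCof = subtopology ?T InvCof"
      by (simp add: subtopology_subtopology Int_absorb1)
    ultimately have "openin (subtopology ?T InvCof) {P \<in> InvCof. ?v P \<in> V}" by (simp only:)
    \<comment> \<open>Openness of \<open>InvCof\<close> in \<open>Inv\<close>, which rests on finite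
      generation, lifts relative openness to \<open>Inv\<close>.\<close>
    then show ?thesis unfolding openin_open_subtopology[OF openin_InvCof[OF S]] by blast
  qed
  show ?thesis
    unfolding continuous_map_def
  proof (intro conjI allI impI)
    show "psi_tilde G H x b y \<in> topspace ?T \<rightarrow> topspace (Alexandroff_compactification (Euclidean_space b))"
      by (auto simp: psi_tilde_def topspace_Euclidean_space)
  next
    fix W assume "openin (Alexandroff_compactification (Euclidean_space b)) W"
    then consider V where "openin (Euclidean_space b) V" "W = Some ` V"
      | C where "compactin (Euclidean_space b) C" "closedin (Euclidean_space b) C"
          "W = insert None (Some ` (topspace (Euclidean_space b) - C))"
      unfolding openin_Alexandroff_compactification by blast
    then show "openin ?T {P \<in> topspace ?T. psi_tilde G H x b y P \<in> W}"
    proof cases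
      case 1
      then have "{P \<in> topspace ?T. psi_tilde G H x b y P \<in> W} = {P \<in> InvCof. ?v P \<in> V}"
        unfolding topspace_Inv by (auto simp: psi_tilde_def split: if_splits)
      then show ?thesis using finite_part[OF 1(1)] by simp
    next
      case 2
      show ?thesis
      proof (subst openin_subopen, intro ballI)
        fix P assume "P \<in> {P \<in> topspace ?T. psi_tilde G H x b y P \<in> W}"
        then have P: "P \<in> Inv" "psi_tilde G H x b y P \<in> W" unfolding topspace_Inv by auto
        show "\<exists>U. openin ?T U \<and> P \<in> U \<and> U \<subseteq> {P \<in> topspace ?T. psi_tilde G H x b y P \<in> W}"
        proof (cases "P \<in> Cof G H x")
          case True
          let ?U = "{P \<in> InvCof. ?v P \<in> topspace (Euclidean_space b) - C}"
          have "openin ?T ?U" using 2 by (intro finite_part openin_diff) auto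
          moreover have "P \<in> ?U" using P True 2 by (auto simp: psi_tilde_def)
          moreover have "?U \<subseteq> {P \<in> topspace ?T. psi_tilde G H x b y P \<in> W}"
            unfolding topspace_Inv using 2 by (auto simp: psi_tilde_def)
          ultimately show ?thesis by blast
        next
          case False
          obtain U where U: "openin ?T U" "P \<in> U" "\<And>Q. Q \<in> U \<Longrightarrow> psi_tilde G H x b y Q \<notin> Some ` C"
            using psi_tilde_escapes[OF trivial basis P(1) False 2(1)] by blast
          have "psi_tilde G H x b y Q \<in> W" if "Q \<in> U" for Q
            using U(3)[OF that] 2(3) by (auto simp: psi_tilde_def topspace_Euclidean_space split: if_splits)
          then show ?thesis using U openin_subset[OF U(1)] by blast
        qed
      qed
    qed
  qed
qed

end

theorem theorem2:
  fixes G :: "('a, 'm) monoid_scheme" and x :: 'a and H :: "'a set"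
    and b :: nat and y :: "nat \<Rightarrow> 'a"
  assumes "group G"
    and "x \<in> carrier G"
    and "subgroup H G"
    and "\<exists>S. finite S \<and> S \<subseteq> carrier G \<and> generate G S = H"
    and "carrier (Hb2 (G\<lparr>carrier := H\<rparr>) :: ('a \<times> 'a \<Rightarrow> real) set monoid)
           = {\<one>\<^bsub>Hb2 (G\<lparr>carrier := H\<rparr>)\<^esub>}"
    and "b = betti1 (G\<lparr>carrier := H\<rparr>)"
    and "homology1_basis (G\<lparr>carrier := H\<rparr>) b y"
  shows "continuous_map (subtopology (LO_topology G) (InvLO G H x \<inter> Cof G H x))
           (Hb2_topology (G\<lparr>carrier := H\<rparr>) b y) (psi G H x) \<and>
         continuous_map (subtopology (LO_topology G) (InvLO G H x))
           (Alexandroff_compactification (Euclidean_space b)) (psi_tilde G H x b y)"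
proof -
  interpret cofinal_element G x H
    using assms(1-3) by (simp add: cofinal_element_def cofinal_element_axioms_def)
  obtain S where S: "finite S" "generate G S = H" using assms(4) by blast
  have "y i \<in> H" if "i < b" for i using assms(7) that by (simp add: homology1_basis_def)
  then show ?thesis
    using continuous_psi[OF assms(5)] continuous_psi_tilde[OF S assms(5,7)] by blast
qed

end
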